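(* Let $X$ be a locally uniformly convex complex Banach space, and let $\mathcal{A}(B_X)$ denote either $\mathcal{A}_b(B_X)$ or $\mathcal{A}_u(B_X)$. Then the set of all strong peak functions in $\mathcal{A}(B_X)$ is a dense $G_\delta$ subset of $\mathcal{A}(B_X)$. In particular, the set of all smooth points of the unit ball $B_{\mathcal{A}(B_X)}$ contains a dense $G_\delta$ subset of the unit sphere $S_{\mathcal{A}(B_X)}$.
   Context: $B_X$ is the closed unit ball of $X$ with its norm metric, and $C_b(B_X)$ is the Banach space of bounded continuous complex-valued functions on $B_X$ with the sup norm. $\mathcal{A}_b(B_X)$ is the subspace of all $f\in C_b(B_X)$ that are holomorphic on the interior of $B_X$, and $\mathcal{A}_u(B_X)$ is the subspace of all $f\in\mathcal{A}_b(B_X)$ that are uniformly continuous on $B_X$. For a subspace $A$ of $C_b(B_X)$, a nonzero function $f\in A$ is a strong peak function if there is $t\in B_X$ such that, whenever $(t_k)$ is a sequence in $B_X$ with $\lim_k|f(t_k)|=\|f\|$, we have $\lim_kt_k=t$. For a Banach space $E$ with closed unit ball $B_E$, a point $x\in B_E$ is a smooth point of $B_E$ if there is a unique $x^*\in B_{E^*}$ with $\operatorname{Re}x^*(x)=1$. *)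

theory Defs
  imports "HOL-Analysis.Analysis"
begin

section \<open>Complex Banach spaces\<close>

text \<open>
  A complex normed space is a real normed space with a compatible multiplication by complex
  scalars; real differentiability, the metric and the topology are those of the real structure.
\<close>

class complex_normed_vector = real_normed_vector +
  fixes scaleC :: "complex \<Rightarrow> 'a \<Rightarrow> 'a" (infixr \<open>*\<^sub>C\<close> 75)
  assumes scaleC_add_right: "a *\<^sub>C (x + y) = a *\<^sub>C x + a *\<^sub>C y"
    and scaleC_add_left: "(a + b) *\<^sub>C x = a *\<^sub>C x + b *\<^sub>C x"
    and scaleC_scaleC: "a *\<^sub>C b *\<^sub>C x = (a * b) *\<^sub>C x"
    and scaleC_of_real: "complex_of_real r *\<^sub>C x = r *\<^sub>R x"
    and norm_scaleC: "norm (a *\<^sub>C x) = cmod a * norm x"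

class complex_banach = complex_normed_vector + banach

instantiation complex :: complex_banach
begin

definition scaleC_complex :: "complex \<Rightarrow> complex \<Rightarrow> complex"
  where "scaleC_complex a z = a * z"

instance
  by standard
    (simp_all add: scaleC_complex_def algebra_simps norm_mult scaleR_conv_of_real)

end

lemma bcontfun_scaleC:
  fixes f :: "'a::topological_space \<Rightarrow> 'b::complex_normed_vector"
  assumes "f \<in> bcontfun"
  shows "(\<lambda>x. c *\<^sub>C f x) \<in> bcontfun"
proof -
  have "bounded_linear (\<lambda>y::'b. c *\<^sub>C y)"
  proof (rule bounded_linear_intro)
    fix r :: real and y :: 'b
    show "c *\<^sub>C r *\<^sub>R y = r *\<^sub>R c *\<^sub>C y"
      by (metis mult.commute scaleC_of_real scaleC_scaleC)
    show "norm (c *\<^sub>C y) \<le> norm y * cmod c"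
      by (simp add: norm_scaleC)
  qed (rule scaleC_add_right)
  then show ?thesis
    using assms bounded_linear_image[of "range f" "\<lambda>y. c *\<^sub>C y"]
    by (auto simp: bcontfun_def image_image intro: bounded_linear.continuous_on)
qed

instantiation bcontfun :: (topological_space, complex_normed_vector) complex_normed_vector
begin

definition scaleC_bcontfun :: "complex \<Rightarrow> ('a \<Rightarrow>\<^sub>C 'b) \<Rightarrow> ('a \<Rightarrow>\<^sub>C 'b)"
  where "scaleC_bcontfun c f = Bcontfun (\<lambda>x. c *\<^sub>C apply_bcontfun f x)"

lemma apply_bcontfun_scaleC:
  fixes f :: "'a \<Rightarrow>\<^sub>C 'b"
  shows "apply_bcontfun (c *\<^sub>C f) x = c *\<^sub>C apply_bcontfun f x"
  unfolding scaleC_bcontfun_def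
  using bcontfun_scaleC[OF apply_bcontfun[of f], of c] by (simp add: Bcontfun_inverse)

instance
proof
  fix a b :: complex and r :: real and f g :: "'a \<Rightarrow>\<^sub>C 'b"
  show "a *\<^sub>C (f + g) = a *\<^sub>C f + a *\<^sub>C g"
    by (rule bcontfun_eqI) (simp add: apply_bcontfun_scaleC scaleC_add_right)
  show "(a + b) *\<^sub>C f = a *\<^sub>C f + b *\<^sub>C f"
    by (rule bcontfun_eqI) (simp add: apply_bcontfun_scaleC scaleC_add_left)
  show scale_scale: "a *\<^sub>C b *\<^sub>C f = (a * b) *\<^sub>C f" for a b and f :: "'a \<Rightarrow>\<^sub>C 'b"
    by (rule bcontfun_eqI) (simp add: apply_bcontfun_scaleC scaleC_scaleC)
  show scale_real: "complex_of_real r *\<^sub>C f = r *\<^sub>R f" for r and f :: "'a \<Rightarrow>\<^sub>C 'b"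
    by (rule bcontfun_eqI) (simp add: apply_bcontfun_scaleC scaleC_of_real)
  have le: "norm (c *\<^sub>C h) \<le> cmod c * norm h" for c and h :: "'a \<Rightarrow>\<^sub>C 'b"
    by (rule norm_bound)
      (simp add: apply_bcontfun_scaleC norm_scaleC mult_left_mono norm_bounded)
  show "norm (a *\<^sub>C f) = cmod a * norm f"
  proof (cases "a = 0")
    case True
    then show ?thesis
      using le[of a f] by simp
  next
    case False
    have "f = inverse a *\<^sub>C a *\<^sub>C f"
      using False scale_real[of 1 f] by (simp add: scale_scale)
    then have "norm f \<le> cmod (inverse a) * norm (a *\<^sub>C f)"
      by (metis le)
    then have "cmod a * norm f \<le> norm (a *\<^sub>C f)"
      using False by (simp add: norm_inverse norm_divide field_simps)
    with le[of a f] show ?thesis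
      by simp
  qed
qed

end

instance bcontfun :: (metric_space, complex_banach) complex_banach ..

definition locally_uniformly_convex :: "'a::real_normed_vector itself \<Rightarrow> bool"
  where "locally_uniformly_convex _ \<longleftrightarrow>
    (\<forall>(x::'a) (s::nat \<Rightarrow> 'a).
      x \<in> sphere 0 1 \<longrightarrow> (\<forall>n. s n \<in> cball 0 1) \<longrightarrow>
      (\<lambda>n. norm (s n + x)) \<longlonglongrightarrow> 2 \<longrightarrow> s \<longlonglongrightarrow> x)"

text \<open>Complex Frechet differentiability at every point of an open set.\<close>

definition cfrechet_holomorphic_on ::
    "('a::complex_normed_vector \<Rightarrow> 'b::complex_normed_vector) \<Rightarrow> 'a set \<Rightarrow> bool"
  where "cfrechet_holomorphic_on g U \<longleftrightarrow> open U \<and>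
    (\<forall>x\<in>U. \<exists>D. (g has_derivative D) (at x) \<and> (\<forall>c v. D (c *\<^sub>C v) = c *\<^sub>C D v))"


section \<open>The closed unit ball and its function spaces\<close>

typedef (overloaded) 'a unit_ball = "cball (0::'a::real_normed_vector) 1"
  morphisms of_unit_ball to_unit_ball
  by (rule exI[of _ 0]) simp

instantiation unit_ball :: (real_normed_vector) metric_space
begin

definition dist_unit_ball :: "'a unit_ball \<Rightarrow> 'a unit_ball \<Rightarrow> real"
  where "dist_unit_ball s t = dist (of_unit_ball s) (of_unit_ball t)"

definition uniformity_unit_ball :: "('a unit_ball \<times> 'a unit_ball) filter"
  where "uniformity_unit_ball = (INF e\<in>{0 <..}. principal {(s, t). dist s t < e})"

definition open_unit_ball :: "'a unit_ball set \<Rightarrow> bool"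
  where "open_unit_ball U = (\<forall>s\<in>U. \<forall>\<^sub>F (s', t) in uniformity. s' = s \<longrightarrow> t \<in> U)"

instance
proof
  fix s t u :: "'a unit_ball"
  show "dist s t = 0 \<longleftrightarrow> s = t"
    by (simp add: dist_unit_ball_def of_unit_ball_inject)
  show "dist s t \<le> dist s u + dist t u"
    by (simp add: dist_unit_ball_def dist_triangle2)
qed (rule open_unit_ball_def uniformity_unit_ball_def)+

end

text \<open>
  With this metric, \<open>'a unit_ball \<Rightarrow>\<^sub>C complex\<close> is $C_b(B_X)$ with the supremum norm.
  The value of \<open>to_unit_ball\<close> outside the ball is arbitrary, but it has no influence on
  differentiability at interior points of the ball.
\<close>

definition A_b :: "('a::complex_normed_vector unit_ball \<Rightarrow>\<^sub>C complex) set"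
  where "A_b = {f. cfrechet_holomorphic_on (\<lambda>x. apply_bcontfun f (to_unit_ball x))
                     (interior (cball 0 1))}"

definition A_u :: "('a::complex_normed_vector unit_ball \<Rightarrow>\<^sub>C complex) set"
  where "A_u = {f \<in> A_b. uniformly_continuous_on UNIV (apply_bcontfun f)}"

definition strong_peak_functions ::
    "('k::metric_space \<Rightarrow>\<^sub>C complex) set \<Rightarrow> ('k \<Rightarrow>\<^sub>C complex) set"
  where "strong_peak_functions A = {f \<in> A. f \<noteq> 0 \<and>
    (\<exists>t. \<forall>s::nat \<Rightarrow> 'k. (\<lambda>k. cmod (apply_bcontfun f (s k))) \<longlonglongrightarrow> norm f \<longrightarrow> s \<longlonglongrightarrow> t)}"


section \<open>Smooth points and dense \<open>G\<^sub>\<delta>\<close> sets\<close>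

text \<open>
  A Banach space is given here as a complex subspace \<open>E\<close> of an ambient complex normed space.
  Functionals on \<open>E\<close> are extensional functions, so that equality of functionals is equality
  on \<open>E\<close> (and not on the ambient space).
\<close>

definition dual_unit_ball :: "'e::complex_normed_vector set \<Rightarrow> ('e \<Rightarrow> complex) set"
  where "dual_unit_ball E = {\<phi> \<in> extensional E.
    (\<forall>x\<in>E. \<forall>y\<in>E. \<phi> (x + y) = \<phi> x + \<phi> y) \<and>
    (\<forall>c. \<forall>x\<in>E. \<phi> (c *\<^sub>C x) = c * \<phi> x) \<and>
    (\<forall>x\<in>E. cmod (\<phi> x) \<le> norm x)}"

definition smooth_points :: "'e::complex_normed_vector set \<Rightarrow> 'e set"
  where "smooth_points E =
    {x \<in> E \<inter> cball 0 1. \<exists>!\<phi>. \<phi> \<in> dual_unit_ball E \<and> Re (\<phi> x) = 1}"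

definition dense_gdelta_in :: "'a topology \<Rightarrow> 'a set \<Rightarrow> bool"
  where "dense_gdelta_in T S \<longleftrightarrow> gdelta_in T S \<and> T closure_of S = topspace T"

end

theory Submission
  imports Defs "HOL-Complex_Analysis.Complex_Analysis"
begin

text \<open>
  A function is a strong peak function iff for every \<open>r > 0\<close> its values of almost maximal modulus
  are all taken in one ball of radius \<open>r\<close>; for fixed \<open>r\<close> this is an open condition. By Baire it
  remains to see that each of these open sets is dense. If \<open>F\<close> is a norming functional at a unit
  vector \<open>x\<close>, then \<open>((1 + F) / 2) ^ m\<close> lies in the algebra, equals 1 at \<open>x\<close>, and by local uniform
  convexity it is small off a given ball around \<open>x\<close> once \<open>m\<close> is large. By the maximum modulus
  principle on complex discs, \<open>f\<close> almost attains its norm at such an \<open>x\<close>, so that adding a small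
  multiple of \<open>((1 + F) / 2) ^ m\<close> with the right phase moves \<open>f\<close> into the open set.

  At a normalized strong peak function the norm is Gateaux differentiable, because near-maximizers
  of \<open>f + s h\<close> converge to the peak point \<open>t\<close> as \<open>s\<close> tends to 0. The only supporting functional
  at \<open>f\<close> is therefore evaluation at \<open>t\<close> times the conjugate of \<open>f t\<close>.
\<close>

section \<open>Norming functionals\<close>

lemma le_cINF_add:
  fixes a :: real
  assumes "I \<noteq> {}" "J \<noteq> {}" "\<And>i j. i \<in> I \<Longrightarrow> j \<in> J \<Longrightarrow> a \<le> f i + g j"
  shows "a \<le> (INF i\<in>I. f i) + (INF j\<in>J. g j)"
proof -
  have "a - g j \<le> (INF i\<in>I. f i)" if "j \<in> J" for j
    using assms that by (intro cINF_greatest) (auto simp: algebra_simps)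
  then have "a - (INF i\<in>I. f i) \<le> (INF j\<in>J. g j)"
    using assms by (intro cINF_greatest) (auto simp: algebra_simps)
  then show ?thesis
    by simp
qed

definition sublinear :: "('a::real_vector \<Rightarrow> real) \<Rightarrow> bool"
  where "sublinear p \<longleftrightarrow>
    (\<forall>x y. p (x + y) \<le> p x + p y) \<and> (\<forall>c\<ge>0. \<forall>x. p (c *\<^sub>R x) = c * p x)"

text \<open>For \<open>c > 0\<close> one inequality suffices: applied to \<open>inverse c\<close>
  and \<open>c *\<^sub>R x\<close> it gives the other one.\<close>

lemma sublinearI:
  assumes "\<And>x y. p (x + y) \<le> p x + p y"
    and "\<And>c x. c > 0 \<Longrightarrow> p (c *\<^sub>R x) \<le> c * p x"
    and "p 0 = 0"
  shows "sublinear p"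
  unfolding sublinear_def
proof (intro conjI allI impI)
  fix c :: real and x assume "0 \<le> c"
  show "p (c *\<^sub>R x) = c * p x"
  proof (cases "c = 0")
    case False
    with \<open>0 \<le> c\<close> have "c > 0" by simp
    then have "p (inverse c *\<^sub>R c *\<^sub>R x) \<le> inverse c * p (c *\<^sub>R x)"
      by (intro assms(2)) simp
    with \<open>c > 0\<close> have "c * p x \<le> p (c *\<^sub>R x)"
      by (simp add: field_simps)
    with assms(2)[OF \<open>c > 0\<close>] show ?thesis
      by (intro antisym) auto
  qed (use assms(3) in simp)
qed (rule assms(1))

lemma sublinear_add: "sublinear p \<Longrightarrow> p (x + y) \<le> p x + p y"
  and sublinear_scaleR: "sublinear p \<Longrightarrow> 0 \<le> c \<Longrightarrow> p (c *\<^sub>R x) = c * p x"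
  and sublinear_zero: "sublinear p \<Longrightarrow> p 0 = 0"
  unfolding sublinear_def by (blast, blast, metis order_refl mult_zero_left scaleR_zero_left)

lemma sublinear_minus: "sublinear p \<Longrightarrow> - p (- x) \<le> p x"
  using sublinear_add[of p x "- x"] sublinear_zero[of p] by simp

text \<open>
  A minimal sublinear functional \<open>p\<close> coincides with all the functionals \<open>sublinear_along p x\<close>,
  and these satisfy \<open>sublinear_along p x (- x) \<le> - p x\<close>; hence \<open>p\<close> is odd, and so linear.
\<close>

definition sublinear_along :: "('a::real_vector \<Rightarrow> real) \<Rightarrow> 'a \<Rightarrow> 'a \<Rightarrow> real"
  where "sublinear_along p x y = (INF t\<in>{0..}. p (y + t *\<^sub>R x) - t * p x)"

lemma sublinear_along_le:
  assumes "sublinear p" "0 \<le> t"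
  shows "sublinear_along p x y \<le> p (y + t *\<^sub>R x) - t * p x"
  unfolding sublinear_along_def
proof (rule cINF_lower)
  \<comment> \<open>A lower bound independent of \<open>t\<close>:
    \<open>t * p x = p (t *\<^sub>R x)\<close>, and \<open>t *\<^sub>R x\<close> is the sum of
    \<open>y + t *\<^sub>R x\<close> and \<open>- y\<close>.\<close>
  have "- p (- y) \<le> p (y + t *\<^sub>R x) - t * p x" if "0 \<le> t" for t
    using sublinear_add[OF assms(1), of "y + t *\<^sub>R x" "- y"] sublinear_scaleR[OF assms(1) that, of x]
    by simp
  then show "bdd_below ((\<lambda>t. p (y + t *\<^sub>R x) - t * p x) ` {0..})"
    by (intro bdd_belowI2) auto
qed (use assms in simp)

text \<open>For subadditivity the parameters \<open>t\<close> and \<open>s\<close> combine to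
  \<open>t + s\<close>; for homogeneity \<open>t\<close> is replaced by
  \<open>c * t\<close>.\<close>

lemma sublinear_sublinear_along:
  assumes p: "sublinear p"
  shows "sublinear (sublinear_along p x)"
proof (rule sublinearI)
  fix y z
  show "sublinear_along p x (y + z) \<le> sublinear_along p x y + sublinear_along p x z"
    unfolding sublinear_along_def[of p x y] sublinear_along_def[of p x z]
  proof (rule le_cINF_add)
    fix t s :: real assume "t \<in> {0..}" "s \<in> {0..}"
    then have "sublinear_along p x (y + z) \<le> p (y + z + (t + s) *\<^sub>R x) - (t + s) * p x"
      by (intro sublinear_along_le p) auto
    also have "y + z + (t + s) *\<^sub>R x = (y + t *\<^sub>R x) + (z + s *\<^sub>R x)"
      by (simp add: algebra_simps)
    also have "p \<dots> - (t + s) * p x \<le> (p (y + t *\<^sub>R x) - t * p x) + (p (z + s *\<^sub>R x) - s * p x)"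
      using sublinear_add[OF p, of "y + t *\<^sub>R x" "z + s *\<^sub>R x"] by (simp add: algebra_simps)
    finally show "sublinear_along p x (y + z) \<le> \<dots>" .
  qed auto
next
  fix c :: real and y assume c: "c > 0"
  have "sublinear_along p x (c *\<^sub>R y) / c \<le> sublinear_along p x y"
    unfolding sublinear_along_def[of p x y]
  proof (rule cINF_greatest)
    fix t :: real assume t: "t \<in> {0..}"
    have "sublinear_along p x (c *\<^sub>R y) \<le> p (c *\<^sub>R y + (c * t) *\<^sub>R x) - (c * t) * p x"
      using c t by (intro sublinear_along_le p) auto
    also have "c *\<^sub>R y + (c * t) *\<^sub>R x = c *\<^sub>R (y + t *\<^sub>R x)"
      by (simp add: algebra_simps)
    also have "p \<dots> = c * p (y + t *\<^sub>R x)"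
      using c by (intro sublinear_scaleR p) auto
    finally show "sublinear_along p x (c *\<^sub>R y) / c \<le> p (y + t *\<^sub>R x) - t * p x"
      using c by (simp add: field_simps)
  qed auto
  then show "sublinear_along p x (c *\<^sub>R y) \<le> c * sublinear_along p x y"
    using c by (simp add: field_simps)
next
  have "sublinear_along p x 0 = (INF t\<in>{0::real..}. 0)"
    unfolding sublinear_along_def using sublinear_scaleR[OF p, of _ x]
    by (intro INF_cong) auto
  then show "sublinear_along p x 0 = 0"
    by simp
qed

text \<open>Zorn's lemma for the reversed pointwise order: the pointwise infimum of a nonempty chain
  is again sublinear.\<close>

lemma ex_minimal_sublinear:
  assumes p: "sublinear p"
  obtains q where "sublinear q" "q \<le> p" "\<And>r. sublinear r \<Longrightarrow> r \<le> q \<Longrightarrow> r = q"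
proof -
  let ?A = "{q. sublinear q \<and> q \<le> p}"
  have "\<exists>q\<in>?A. \<forall>r\<in>?A. r \<le> q \<longrightarrow> r = q"
  proof (rule predicate_Zorn)
    show "partial_order_on ?A (relation_of (\<lambda>q r. r \<le> q) ?A)"
      by (auto simp: partial_order_on_def preorder_on_def refl_on_def trans_def antisym_def relation_of_def
          intro: order_trans antisym)
  next
    fix C assume C: "C \<in> Chains (relation_of (\<lambda>q r. r \<le> q) ?A)"
    then have sub: "\<And>q. q \<in> C \<Longrightarrow> sublinear q \<and> q \<le> p"
      and tot: "\<And>q r. q \<in> C \<Longrightarrow> r \<in> C \<Longrightarrow> q \<le> r \<or> r \<le> q"
      by (auto simp: Chains_def relation_of_def)
    show "\<exists>u\<in>?A. \<forall>q\<in>C. u \<le> q"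
    proof (cases "C = {}")
      case True
      with p show ?thesis by auto
    next
      case False
      define u where "u = (\<lambda>x. INF q\<in>C. q x)"
      have u_le: "u x \<le> q x" if "q \<in> C" for q x
        unfolding u_def
      proof (rule cINF_lower[OF _ that])
        \<comment> \<open>This bound is common to all members of the chain, so the infimum is
          finite.\<close>
        have "- p (- x) \<le> r x" if "r \<in> C" for r
          using sublinear_minus[of r x] sub[OF that] le_funD[of r p "- x"] by linarith
        then show "bdd_below ((\<lambda>q. q x) ` C)"
          by (intro bdd_belowI2) auto
      qed
      have "sublinear u"
      proof (rule sublinearI)
        fix x y
        show "u (x + y) \<le> u x + u y"
          unfolding u_def[THEN fun_cong, of x] u_def[THEN fun_cong, of y]
        proof (rule le_cINF_add[OF False False])
          fix q r assume "q \<in> C" "r \<in> C"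
          \<comment> \<open>The smaller of \<open>q\<close> and \<open>r\<close>; its subadditivity
            bounds \<open>u (x + y)\<close> by \<open>q x + r y\<close>.\<close>
          then obtain m where "m \<in> C" "m \<le> q" "m \<le> r"
            using tot by blast
          then show "u (x + y) \<le> q x + r y"
            using u_le[of m "x + y"] sublinear_add[of m x y] sub[of m]
              le_funD[of m q x] le_funD[of m r y] by linarith
        qed
      next
        fix c :: real and x assume c: "c > 0"
        have "u (c *\<^sub>R x) / c \<le> u x"
          unfolding u_def[THEN fun_cong, of x]
        proof (rule cINF_greatest[OF False])
          fix q assume "q \<in> C"
          then show "u (c *\<^sub>R x) / c \<le> q x"
            using u_le[of q "c *\<^sub>R x"] sublinear_scaleR[of q c x] sub[of q] c
            by (simp add: field_simps)
        qed
        then show "u (c *\<^sub>R x) \<le> c * u x"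
          using c by (simp add: field_simps)
      next
        have "u 0 = (INF q\<in>C. 0)"
          unfolding u_def using sub sublinear_zero by (intro INF_cong) auto
        with False show "u 0 = 0" by simp
      qed
      moreover have "u \<le> p"
      proof -
        obtain q where "q \<in> C" using False by blast
        then have "u \<le> q" "q \<le> p"
          using u_le sub by (auto intro: le_funI)
        then show ?thesis by (rule order_trans)
      qed
      moreover have "\<forall>q\<in>C. u \<le> q"
        using u_le by (simp add: le_funI)
      ultimately show ?thesis
        by blast
    qed
  qed
  then obtain q where q: "q \<in> ?A" "\<And>r. r \<in> ?A \<Longrightarrow> r \<le> q \<Longrightarrow> r = q"
    by blast
  show thesis
    using q by (intro that[of q]) (auto intro: order_trans)
qed

lemma minimal_sublinear_minus:
  assumes q: "sublinear q" and min: "\<And>r. sublinear r \<Longrightarrow> r \<le> q \<Longrightarrow> r = q"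
  shows "q (- x) = - q x"
proof -
  have "sublinear_along q x \<le> q"
    using sublinear_along_le[OF q, of 0 x] by (simp add: le_fun_def)
  then have "sublinear_along q x = q"
    by (intro min sublinear_sublinear_along q)
  \<comment> \<open>Taking \<open>t = 1\<close> at \<open>- x\<close> gives
    \<open>q (- x) \<le> q 0 - q x\<close>; the reverse inequality holds for every sublinear
    functional.\<close>
  then show ?thesis
    using sublinear_along_le[OF q, of 1 x "- x"] sublinear_zero[OF q] sublinear_minus[OF q, of "- x"]
    by simp
qed

text \<open>Since \<open>q\<close> is odd, subadditivity at \<open>x\<close>, \<open>y\<close> and
  at \<open>- x\<close>, \<open>- y\<close> gives the two inequalities for additivity; oddness also
  covers negative scalars.\<close>

lemma minimal_sublinear_linear:
  assumes q: "sublinear q" and min: "\<And>r. sublinear r \<Longrightarrow> r \<le> q \<Longrightarrow> r = q"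
  shows "linear q"
proof (rule linearI)
  note minus = minimal_sublinear_minus[OF assms]
  fix x y c
  have "q (- x + - y) \<le> q (- x) + q (- y)"
    by (rule sublinear_add[OF q])
  moreover have "- x + - y = - (x + y)"
    by simp
  ultimately show "q (x + y) = q x + q y"
    using sublinear_add[OF q, of x y] minus[of x] minus[of y] minus[of "x + y"] by simp
  show "q (c *\<^sub>R x) = c *\<^sub>R q x"
    using sublinear_scaleR[OF q, of "\<bar>c\<bar>" x] minus[of "c *\<^sub>R x"] by (cases "c \<ge> 0") auto
qed

text \<open>The minimal functional is taken below \<open>sublinear_along norm x\<close> rather than
  below the norm itself: that functional is at most \<open>- norm x\<close> at \<open>- x\<close>,
  which forces the value of \<open>q\<close> at \<open>x\<close>.\<close>

lemma ex_real_norming_functional: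
  fixes x :: "'a::real_normed_vector"
  obtains q :: "'a \<Rightarrow> real" where "linear q" "\<And>y. q y \<le> norm y" "q x = norm x"
proof -
  have norm: "sublinear (norm :: 'a \<Rightarrow> real)"
    by (simp add: sublinear_def norm_triangle_ineq)
  obtain q where q: "sublinear q" "q \<le> sublinear_along norm x"
    "\<And>r. sublinear r \<Longrightarrow> r \<le> q \<Longrightarrow> r = q"
    using ex_minimal_sublinear[OF sublinear_sublinear_along[OF norm, of x]] by blast
  have lin: "linear q"
    using q(1,3) by (rule minimal_sublinear_linear)
  have le: "q y \<le> norm (y + t *\<^sub>R x) - t * norm x" if "0 \<le> t" for t y
    using q(2) sublinear_along_le[OF norm that, of x y] by (auto simp: le_fun_def intro: order_trans)
  have "q y \<le> norm y" for y
    using le[of 0 y] by simp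
  moreover from this[of x] have "q x = norm x"
    using le[of 1 "- x"] linear_neg[OF lin, of x] by simp
  ultimately show thesis
    using that lin by blast
qed

section \<open>Complex norming functionals\<close>

lemma complex_unit_mult_eq_cmod:
  obtains u :: complex where "cmod u = 1" "u * z = complex_of_real (cmod z)"
proof (cases "z = 0")
  case True
  then show thesis by (intro that[of 1]) auto
next
  case False
  then show thesis
    by (intro that[of "cnj z / cmod z"])
      (auto simp: norm_divide complex_norm_square[symmetric] power2_eq_square mult.commute)
qed

definition clinear_functional :: "('a::complex_normed_vector \<Rightarrow> complex) \<Rightarrow> bool"
  where "clinear_functional F \<longleftrightarrow>
    (\<forall>x y. F (x + y) = F x + F y) \<and> (\<forall>c x. F (c *\<^sub>C x) = c * F x)"

text \<open>The real functional \<open>q\<close> becomes the real part of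
  \<open>F y = q y - \<i> * q (\<i> *\<^sub>C y)\<close>. A rotation making \<open>F y\<close> real
  and nonnegative transfers the bound from \<open>q\<close>, and at \<open>x\<close> this bound
  leaves no room for an imaginary part.\<close>

lemma ex_complex_norming_functional:
  fixes x :: "'a::complex_normed_vector"
  obtains F where "clinear_functional F" "\<And>y. cmod (F y) \<le> norm y" "F x = norm x"
proof -
  obtain q :: "'a \<Rightarrow> real" where q: "linear q" "\<And>y. q y \<le> norm y" "q x = norm x"
    using ex_real_norming_functional[of x] by blast
  define F where "F = (\<lambda>y. Complex (q y) (- q (\<i> *\<^sub>C y)))"
  have Re_F: "Re (F y) = q y" for y
    by (simp add: F_def)
  have scale: "c *\<^sub>C y = Re c *\<^sub>R y + Im c *\<^sub>R \<i> *\<^sub>C y" for c and y :: 'a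
  proof -
    have "c *\<^sub>C y = (complex_of_real (Re c) + complex_of_real (Im c) * \<i>) *\<^sub>C y"
      by (metis complex_eq mult.commute)
    also have "\<dots> = Re c *\<^sub>R y + Im c *\<^sub>R \<i> *\<^sub>C y"
      unfolding scaleC_add_left scaleC_scaleC[symmetric] scaleC_of_real ..
    finally show ?thesis .
  qed
  have ii: "\<i> *\<^sub>C \<i> *\<^sub>C y = - y" for y :: 'a
    using scaleC_of_real[of "-1" y] by (simp add: scaleC_scaleC)
  have add: "F (y + z) = F y + F z" for y z
    by (simp add: F_def complex_eq_iff linear_add[OF q(1)] scaleC_add_right)
  have icomm: "\<i> *\<^sub>C c *\<^sub>C y = c *\<^sub>C \<i> *\<^sub>C y" for c and y :: 'a
    by (simp add: scaleC_scaleC mult.commute)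
  have qc: "q (c *\<^sub>C y) = Re c * q y + Im c * q (\<i> *\<^sub>C y)" for c y
    by (subst scale) (simp add: linear_add[OF q(1)] linear_scale[OF q(1)])
  have mult: "F (c *\<^sub>C y) = c * F y" for c y
    by (simp add: F_def complex_eq_iff icomm[of c] qc[of c] ii linear_neg[OF q(1)])
  have "clinear_functional F"
    using add mult by (simp add: clinear_functional_def)
  moreover have bound: "cmod (F y) \<le> norm y" for y
  proof -
    obtain u where u: "cmod u = 1" "u * F y = complex_of_real (cmod (F y))"
      by (rule complex_unit_mult_eq_cmod)
    then have "cmod (F y) = Re (F (u *\<^sub>C y))"
      by (simp add: mult)
    also have "\<dots> \<le> norm (u *\<^sub>C y)"
      by (simp add: Re_F q(2))
    finally show ?thesis
      using u by (simp add: norm_scaleC)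
  qed
  moreover have "F x = norm x"
  proof (rule complex_eqI)
    show "Re (F x) = Re (norm x)"
      by (simp add: Re_F q(3))
    have "(Re (F x))\<^sup>2 + (Im (F x))\<^sup>2 \<le> (norm x)\<^sup>2"
      using bound[of x] by (metis cmod_power2 norm_ge_zero power_mono)
    then show "Im (F x) = Im (norm x)"
      by (simp add: Re_F q(3))
  qed
  ultimately show thesis
    using that by blast
qed

section \<open>Strong peak functions and smooth points\<close>

text \<open>Carries Baire's theorem over to a topology without a fixed metric, such as the relative
  topology of a closed subspace.\<close>

lemma completely_metrizable_Baire_dense:
  assumes "completely_metrizable_space X" "countable \<G>"
    and "\<And>T. T \<in> \<G> \<Longrightarrow> openin X T \<and> X closure_of T = topspace X"
  shows "X closure_of \<Inter>\<G> = topspace X"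
proof -
  obtain M d where "Metric_space M d" "Metric_space.mcomplete M d" "X = Metric_space.mtopology M d"
    using assms(1) by (auto simp: completely_metrizable_space_def)
  then show ?thesis
    using Metric_space.metric_Baire_category[of M d \<G>] assms(2,3)
    by (simp add: Metric_space.topspace_mtopology)
qed

lemma top_of_set_dense_iff:
  fixes S A :: "'a::metric_space set"
  assumes "S \<subseteq> A"
  shows "top_of_set A closure_of S = A \<longleftrightarrow> (\<forall>f\<in>A. \<forall>e>0. \<exists>g\<in>S. dist g f < e)"
proof -
  have "top_of_set A closure_of S = A \<longleftrightarrow> A \<subseteq> closure S"
    using assms by (auto simp: closure_of_subtopology Int_absorb1)
  then show ?thesis
    by (auto simp: closure_approachable)
qed

section \<open>Strong peak functions as a countable intersection\<close>

lemma bcontfun_cmod_gt: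
  fixes f :: "'k::topological_space \<Rightarrow>\<^sub>C complex"
  assumes "c < norm f"
  obtains x where "c < cmod (apply_bcontfun f x)"
proof -
  have "\<exists>x. c < cmod (apply_bcontfun f x)"
  proof (rule ccontr)
    assume "\<nexists>x. c < cmod (apply_bcontfun f x)"
    then have "norm f \<le> c"
      by (intro norm_bound) (auto simp: not_less)
    with assms show False by simp
  qed
  with that show thesis by blast
qed

text \<open>The constraint \<open>0 \<le> c\<close> excludes the zero function.\<close>

definition almost_peak :: "real \<Rightarrow> ('k::metric_space \<Rightarrow>\<^sub>C complex) set"
  where "almost_peak r = {f. \<exists>z c. 0 \<le> c \<and> c < norm f \<and>
    (\<forall>x. c < cmod (apply_bcontfun f x) \<longrightarrow> dist x z < r)}"

text \<open>A perturbation smaller than \<open>d\<close> changes the norm and all moduli by less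
  than \<open>d\<close>. The centre \<open>z\<close> therefore persists with the threshold
  \<open>c + d\<close>, and \<open>d\<close> is small enough to keep this below
  \<open>norm g\<close>.\<close>

lemma open_almost_peak: "open (almost_peak r)"
  unfolding open_dist
proof
  fix f :: "'k::metric_space \<Rightarrow>\<^sub>C complex" assume "f \<in> almost_peak r"
  then obtain z c where zc: "0 \<le> c" "c < norm f" "\<And>x. c < cmod (apply_bcontfun f x) \<Longrightarrow> dist x z < r"
    by (auto simp: almost_peak_def)
  define d where "d = (norm f - c) / 3"
  have "g \<in> almost_peak r" if g: "dist g f < d" for g
    unfolding almost_peak_def
  proof (intro CollectI exI conjI allI impI)
    show "0 \<le> c + d" and "c + d < norm g"
      using zc(1,2) g norm_triangle_sub[of f g]
      by (auto simp: d_def dist_norm norm_minus_commute field_simps)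
    fix x assume "c + d < cmod (apply_bcontfun g x)"
    moreover have "cmod (apply_bcontfun g x - apply_bcontfun f x) < d"
      using dist_fun_lt_imp_dist_val_lt[OF g, of x] by (simp add: dist_norm)
    ultimately show "dist x z < r"
      using norm_triangle_sub[of "apply_bcontfun g x" "apply_bcontfun f x"] by (intro zc(3)) simp
  qed
  then show "\<exists>e>0. \<forall>g. dist g f < e \<longrightarrow> g \<in> almost_peak r"
    using zc(2) by (intro exI[of _ d]) (auto simp: d_def)
qed

text \<open>With the peak point \<open>t\<close> as centre, failure at every threshold
  \<open>c k\<close> would give near-maximizers that stay at distance at least \<open>r\<close> from
  \<open>t\<close> although they must converge to it.\<close>

lemma strong_peak_functions_subset_almost_peak:
  fixes A :: "('k::metric_space \<Rightarrow>\<^sub>C complex) set"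
  assumes "r > 0"
  shows "strong_peak_functions A \<subseteq> almost_peak r"
proof
  fix f assume "f \<in> strong_peak_functions A"
  then obtain t where "f \<noteq> 0" and t: "\<And>s::nat \<Rightarrow> 'k.
      (\<lambda>k. cmod (apply_bcontfun f (s k))) \<longlonglongrightarrow> norm f \<Longrightarrow> s \<longlonglongrightarrow> t"
    by (auto simp: strong_peak_functions_def)
  then have pos: "norm f > 0" by simp
  define c where "c k = norm f * (1 - inverse (Suc k))" for k :: nat
  have c: "0 \<le> c k" "c k < norm f" for k
    using pos by (auto simp: c_def field_simps)
  show "f \<in> almost_peak r"
  proof (rule ccontr)
    assume "f \<notin> almost_peak r"
    then have "\<forall>k. \<exists>x. c k < cmod (apply_bcontfun f x) \<and> \<not> dist x t < r"
      using c unfolding almost_peak_def by blast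
    then obtain s where s: "\<And>k. c k < cmod (apply_bcontfun f (s k))" "\<And>k. \<not> dist (s k) t < r"
      by metis
    have "c \<longlonglongrightarrow> norm f * (1 - 0)"
      unfolding c_def by (intro tendsto_intros LIMSEQ_inverse_real_of_nat)
    then have "c \<longlonglongrightarrow> norm f"
      by simp
    then have "(\<lambda>k. cmod (apply_bcontfun f (s k))) \<longlonglongrightarrow> norm f"
      by (rule tendsto_sandwich[rotated 2]) (auto intro!: always_eventually less_imp_le[OF s(1)] norm_bounded)
    then have "eventually (\<lambda>k. dist (s k) t < r) sequentially"
      using t assms tendstoD by blast
    with s(2) show False
      by simp
  qed
qed

text \<open>For the converse inclusion, any two of the shrinking balls share a near-maximizer, so
  their centres form a Cauchy sequence; completeness supplies the peak point.\<close>

lemma strong_peak_functions_eq_Inter: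
  fixes A :: "('k::complete_space \<Rightarrow>\<^sub>C complex) set"
  shows "strong_peak_functions A = (\<Inter>n. A \<inter> almost_peak (inverse (real (Suc n))))"
proof
  show "strong_peak_functions A \<subseteq> (\<Inter>n. A \<inter> almost_peak (inverse (real (Suc n))))"
  proof (intro INT_greatest Int_greatest strong_peak_functions_subset_almost_peak)
    show "strong_peak_functions A \<subseteq> A"
      by (auto simp: strong_peak_functions_def)
  qed simp
next
  show "(\<Inter>n. A \<inter> almost_peak (inverse (real (Suc n)))) \<subseteq> strong_peak_functions A"
  proof
    fix f assume f: "f \<in> (\<Inter>n. A \<inter> almost_peak (inverse (real (Suc n))))"
    then have "\<forall>n. \<exists>z c. 0 \<le> c \<and> c < norm f \<and>
        (\<forall>x. c < cmod (apply_bcontfun f x) \<longrightarrow> dist x z < inverse (real (Suc n)))"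
      unfolding almost_peak_def by blast
    then obtain z c where c: "\<And>n. 0 \<le> c n" "\<And>n. c n < norm f"
      and z: "\<And>n x. c n < cmod (apply_bcontfun f x) \<Longrightarrow> dist x (z n) < inverse (real (Suc n))"
      by metis
    have near: "dist (z m) (z n) < inverse (real (Suc m)) + inverse (real (Suc n))" for m n
    proof -
      obtain x where "max (c m) (c n) < cmod (apply_bcontfun f x)"
        using c(2) by (auto intro: bcontfun_cmod_gt[of "max (c m) (c n)" f])
      then show ?thesis
        using z[of m x] z[of n x] dist_triangle3[of "z m" "z n" x] by simp
    qed
    have "Cauchy z"
      unfolding Cauchy_def
    proof (intro allI impI)
      fix e :: real assume "e > 0"
      then obtain N where N: "inverse (real (Suc N)) < e / 2"
        using reals_Archimedean[of "e / 2"] by auto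
      have "dist (z m) (z n) < e" if "m \<ge> N" "n \<ge> N" for m n
      proof -
        have "inverse (real (Suc m)) \<le> inverse (real (Suc N))"
          "inverse (real (Suc n)) \<le> inverse (real (Suc N))"
          using that by (auto intro!: le_imp_inverse_le)
        with near[of m n] N show ?thesis by linarith
      qed
      then show "\<exists>M. \<forall>m\<ge>M. \<forall>n\<ge>M. dist (z m) (z n) < e"
        by blast
    qed
    then obtain t where t: "z \<longlonglongrightarrow> t"
      using Cauchy_convergent by (auto simp: convergent_def)
    have "s \<longlonglongrightarrow> t" if s: "(\<lambda>k. cmod (apply_bcontfun f (s k))) \<longlonglongrightarrow> norm f" for s :: "nat \<Rightarrow> 'k"
    proof (rule tendstoI)
      fix e :: real assume "e > 0"
      then have "\<forall>\<^sub>F n in sequentially. inverse (real (Suc n)) < e / 2 \<and> dist (z n) t < e / 2"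
        using order_tendstoD(2)[OF LIMSEQ_inverse_real_of_nat, of "e / 2"] tendstoD[OF t, of "e / 2"]
        by (intro eventually_conj) auto
      then obtain n where n: "inverse (real (Suc n)) < e / 2" "dist (z n) t < e / 2"
        by (auto simp: eventually_sequentially)
      \<comment> \<open>Beyond the threshold \<open>c n\<close>, the point \<open>s k\<close> lies
        in the ball around \<open>z n\<close>, whose centre is close to \<open>t\<close>.\<close>
      show "\<forall>\<^sub>F k in sequentially. dist (s k) t < e"
        using order_tendstoD(1)[OF s c(2)[of n]]
      proof eventually_elim
        case (elim k)
        show ?case
          using z[OF elim] n dist_triangle[of "s k" t "z n"] by linarith
      qed
    qed
    moreover have "f \<in> A" "f \<noteq> 0"
      using f c(1)[of 0] c(2)[of 0] by auto
    ultimately show "f \<in> strong_peak_functions A"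
      by (auto simp: strong_peak_functions_def)
  qed
qed

section \<open>Density by adding small peaks\<close>

definition csubspace :: "'e::complex_normed_vector set \<Rightarrow> bool"
  where "csubspace A \<longleftrightarrow> (\<forall>f\<in>A. \<forall>g\<in>A. f + g \<in> A) \<and> (\<forall>c. \<forall>f\<in>A. c *\<^sub>C f \<in> A)"

lemma csubspace_add: "csubspace A \<Longrightarrow> f \<in> A \<Longrightarrow> g \<in> A \<Longrightarrow> f + g \<in> A"
  and csubspace_scaleC: "csubspace A \<Longrightarrow> f \<in> A \<Longrightarrow> c *\<^sub>C f \<in> A"
  by (auto simp: csubspace_def)

lemma csubspace_scaleR: "csubspace A \<Longrightarrow> f \<in> A \<Longrightarrow> r *\<^sub>R f \<in> A"
  using csubspace_scaleC[of A f "complex_of_real r"] by (simp add: scaleC_of_real)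

lemma scaleC_complex_eq [simp]: "c *\<^sub>C z = c * z" for z :: complex
  by (simp add: scaleC_complex_def)

lemma scaleC_zero_left [simp]: "0 *\<^sub>C x = 0"
  using scaleC_of_real[of 0 x] by simp

text \<open>The gap between 1 at \<open>x\<close> and 1/2 off the ball is what separates the
  near-maximizers in \<open>almost_peak_dense\<close>.\<close>

definition peaks_near :: "('k::metric_space \<Rightarrow>\<^sub>C complex) \<Rightarrow> 'k \<Rightarrow> real \<Rightarrow> bool"
  where "peaks_near h x r \<longleftrightarrow> norm h \<le> 1 \<and> apply_bcontfun h x = 1 \<and>
    (\<forall>y. r \<le> dist y x \<longrightarrow> cmod (apply_bcontfun h y) \<le> 1 / 2)"

text \<open>Together with linearity, this is all that the density argument asks of a function space;
  local uniform convexity enters only when it is verified.\<close>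

definition has_norming_peaks :: "('k::metric_space \<Rightarrow>\<^sub>C complex) set \<Rightarrow> bool"
  where "has_norming_peaks A \<longleftrightarrow> (\<forall>f\<in>A. \<forall>c<norm f. \<forall>r>0.
    \<exists>x. c < cmod (apply_bcontfun f x) \<and> (\<exists>h\<in>A. peaks_near h x r))"

text \<open>At \<open>x\<close> the added peak contributes its full size \<open>e\<close>, so
  \<open>norm g\<close> exceeds \<open>norm f + 3 * e / 4\<close>; off the ball it contributes at
  most \<open>e / 2\<close>. Hence \<open>norm f + e / 2\<close> is a threshold for
  \<open>g\<close>.\<close>

lemma almost_peak_dense:
  assumes A: "csubspace A" "has_norming_peaks A"
    and f: "f \<in> A" and "r > 0" "e > 0"
  shows "\<exists>g\<in>A \<inter> almost_peak r. dist g f \<le> e"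
proof -
  have "norm f - e / 4 < norm f"
    using \<open>e > 0\<close> by simp
  then obtain x h where x: "norm f - e / 4 < cmod (apply_bcontfun f x)"
    and "h \<in> A" "peaks_near h x r"
    using A(2) f \<open>r > 0\<close> unfolding has_norming_peaks_def by blast
  then have h: "h \<in> A" "norm h \<le> 1" "apply_bcontfun h x = 1"
    "\<And>y. r \<le> dist y x \<Longrightarrow> cmod (apply_bcontfun h y) \<le> 1 / 2"
    by (simp_all add: peaks_near_def)
  obtain u where u: "cmod u = 1" "u * apply_bcontfun f x = complex_of_real (cmod (apply_bcontfun f x))"
    by (rule complex_unit_mult_eq_cmod)
  \<comment> \<open>Multiplication by \<open>u\<close> makes both terms of \<open>g\<close> at
    \<open>x\<close> real and nonnegative, so their moduli add.\<close>
  define w where "w = complex_of_real e * cnj u"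
  have w: "cmod w = e"
    using u assms by (simp add: w_def norm_mult)
  define g where "g = f + w *\<^sub>C h"
  have gy: "apply_bcontfun g y = apply_bcontfun f y + w * apply_bcontfun h y" for y
    by (simp add: g_def apply_bcontfun_scaleC)
  have "u * cnj u = 1"
    using u by (simp add: complex_norm_square[symmetric])
  then have "u * apply_bcontfun g x = complex_of_real (cmod (apply_bcontfun f x) + e)"
    using u(2) by (simp add: gy h(3) w_def algebra_simps)
  then have "cmod (u * apply_bcontfun g x) = cmod (apply_bcontfun f x) + e"
    using assms by (simp only: norm_of_real) simp
  then have "norm f - e / 4 + e < norm g"
    using x u(1) norm_bounded[of g x] by (simp add: norm_mult)
  moreover have "dist y x < r" if "norm f + e / 2 < cmod (apply_bcontfun g y)" for y
  proof (rule ccontr)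
    assume "\<not> dist y x < r"
    then have "cmod (w * apply_bcontfun h y) \<le> e * (1 / 2)"
      unfolding norm_mult w using h(4)[of y] assms by (intro mult_left_mono) auto
    then have "cmod (apply_bcontfun g y) \<le> norm f + e / 2"
      using norm_bounded[of f y] norm_triangle_ineq[of "apply_bcontfun f y" "w * apply_bcontfun h y"]
      by (simp add: gy)
    with that show False by simp
  qed
  ultimately have "g \<in> almost_peak r"
    unfolding almost_peak_def using assms(5)
    by (intro CollectI exI[of _ x] exI[of _ "norm f + e / 2"]) auto
  moreover have "g \<in> A"
    unfolding g_def by (intro csubspace_add csubspace_scaleC A f h)
  moreover have "dist g f \<le> e"
    using mult_left_mono[OF h(2), of e] assms by (simp add: g_def dist_norm norm_scaleC w)
  ultimately show ?thesis by blast
qed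

text \<open>Baire's theorem applies since a closed subset of a complete metric space is completely
  metrizable; \<open>almost_peak_dense\<close> supplies the density of the relatively open
  sets.\<close>

theorem strong_peak_functions_dense_gdelta:
  fixes A :: "('k::complete_space \<Rightarrow>\<^sub>C complex) set"
  assumes A: "csubspace A" "has_norming_peaks A" "closed A"
  shows "dense_gdelta_in (top_of_set A) (strong_peak_functions A)"
  unfolding dense_gdelta_in_def strong_peak_functions_eq_Inter
proof
  let ?U = "\<lambda>n. A \<inter> almost_peak (inverse (real (Suc n)))"
  have op: "openin (top_of_set A) (?U n)" for n
    by (simp add: openin_open_Int open_almost_peak)
  show "gdelta_in (top_of_set A) (\<Inter>n. ?U n)"
  proof (rule gdelta_in_Inter)
    show "gdelta_in (top_of_set A) S" if "S \<in> range ?U" for S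
      using that op open_imp_gdelta_in by blast
  qed auto
  show "top_of_set A closure_of (\<Inter>n. ?U n) = topspace (top_of_set A)"
  proof (rule completely_metrizable_Baire_dense)
    show "completely_metrizable_space (top_of_set A)"
      using A(3) by (intro completely_metrizable_space_closedin completely_metrizable_space_euclidean) auto
    fix T assume "T \<in> range ?U"
    then obtain n where T: "T = ?U n" by blast
    have "\<exists>g\<in>T. dist g f < e" if "f \<in> A" "e > 0" for f e
      using almost_peak_dense[OF A(1,2) that(1), of "inverse (real (Suc n))" "e / 2"] that(2) T
      by force
    then have "top_of_set A closure_of T = A"
      by (subst top_of_set_dense_iff) (auto simp: T)
    then show "openin (top_of_set A) T \<and> top_of_set A closure_of T = topspace (top_of_set A)"
      using op T by simp
  qed simp
qed

text \<open>The square is expanded exactly and the root removed by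
  \<open>2 * r \<le> r\<^sup>2 + 1\<close>, leaving a first-order term and an error quadratic in
  \<open>s\<close>.\<close>

lemma cmod_add_scaleR_le:
  assumes "cmod a \<le> 1"
  shows "cmod (a + s *\<^sub>R b) \<le> 1 + s * Re (cnj a * b) + s\<^sup>2 * (cmod b)\<^sup>2"
proof -
  have "(cmod (a + s *\<^sub>R b))\<^sup>2 = (cmod a)\<^sup>2 + 2 * (s * Re (cnj a * b)) + s\<^sup>2 * (cmod b)\<^sup>2"
    unfolding cmod_power2 by (simp add: power2_eq_square algebra_simps)
  also have "(cmod a)\<^sup>2 \<le> 1"
    using assms by (simp add: power_le_one)
  finally have "(cmod (a + s *\<^sub>R b))\<^sup>2 \<le> 1 + 2 * (s * Re (cnj a * b)) + s\<^sup>2 * (cmod b)\<^sup>2"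
    by simp
  moreover have "2 * cmod (a + s *\<^sub>R b) \<le> (cmod (a + s *\<^sub>R b))\<^sup>2 + 1"
    using sum_squares_bound[of "cmod (a + s *\<^sub>R b)" 1] by simp
  moreover have "0 \<le> s\<^sup>2 * (cmod b)\<^sup>2"
    by simp
  ultimately show ?thesis by linarith
qed

text \<open>Near-maximizers \<open>x n\<close> of \<open>f + s n *\<^sub>R h\<close> also nearly
  maximize \<open>f\<close>, so they tend to \<open>t\<close>, and the first-order expansion at
  \<open>x n\<close> bounds \<open>Re (\<phi> h)\<close>. Applied to multiples of \<open>h\<close>,
  the bound becomes an equality.\<close>

lemma strong_peak_dual_functional:
  fixes f :: "'k::metric_space \<Rightarrow>\<^sub>C complex"
  assumes A: "csubspace A" and f: "f \<in> A" "norm f = 1"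
    and t: "\<And>s::nat \<Rightarrow> 'k. (\<lambda>k. cmod (apply_bcontfun f (s k))) \<longlonglongrightarrow> norm f \<Longrightarrow> s \<longlonglongrightarrow> t"
    and \<phi>: "\<phi> \<in> dual_unit_ball A" "Re (\<phi> f) = 1"
    and h: "h \<in> A"
  shows "\<phi> h = cnj (apply_bcontfun f t) * apply_bcontfun h t"
proof -
  have add: "\<phi> (x + y) = \<phi> x + \<phi> y" if "x \<in> A" "y \<in> A" for x y
    using \<phi>(1) that by (simp add: dual_unit_ball_def)
  have mult: "\<phi> (c *\<^sub>C x) = c * \<phi> x" if "x \<in> A" for x c
    using \<phi>(1) that by (simp add: dual_unit_ball_def)
  have le: "Re (\<phi> x) \<le> norm x" if "x \<in> A" for x
    using \<phi>(1) that complex_Re_le_cmod[of "\<phi> x"] by (force simp: dual_unit_ball_def)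
  have Re_le: "Re (\<phi> h) \<le> Re (cnj (apply_bcontfun f t) * apply_bcontfun h t)" if h: "h \<in> A" for h
  proof -
    define s :: "nat \<Rightarrow> real" where "s n = inverse (real (Suc n))" for n
    have s_pos: "s n > 0" for n by (simp add: s_def)
    have s0: "s \<longlonglongrightarrow> 0"
      unfolding s_def by (rule LIMSEQ_inverse_real_of_nat)
    \<comment> \<open>The slack \<open>(s n)\<^sup>2\<close> is of second order, so it still
      vanishes after division by \<open>s n\<close>.\<close>
    have "\<forall>n. \<exists>x. norm (f + s n *\<^sub>R h) - (s n)\<^sup>2 < cmod (apply_bcontfun (f + s n *\<^sub>R h) x)"
      using s_pos by (metis bcontfun_cmod_gt diff_less_eq less_add_same_cancel1 zero_less_power)
    then obtain x where x: "\<And>n. norm (f + s n *\<^sub>R h) - (s n)\<^sup>2 < cmod (apply_bcontfun (f + s n *\<^sub>R h) (x n))"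
      by metis
    have Re_add: "1 + s n * Re (\<phi> h) \<le> norm (f + s n *\<^sub>R h)" for n
    proof -
      have "\<phi> (f + s n *\<^sub>R h) = \<phi> f + s n * \<phi> h"
        using add[OF f(1) csubspace_scaleR[OF A h]] mult[OF h, of "complex_of_real (s n)"]
        by (simp add: scaleC_of_real)
      then show ?thesis
        using le[OF csubspace_add[OF A f(1) csubspace_scaleR[OF A h]], of "s n"] \<phi>(2) by simp
    qed
    \<comment> \<open>The moduli of \<open>f\<close> at \<open>x n\<close> are squeezed to
      \<open>norm f\<close>: \<open>Re_add\<close> bounds the perturbed norm from below, and the
      \<open>h\<close> part accounts for at most \<open>s n * norm h\<close>.\<close>
    have "x \<longlonglongrightarrow> t"
    proof (rule t, rule tendsto_sandwich)
      have "1 + s n * Re (\<phi> h) - (s n)\<^sup>2 - s n * norm h \<le> cmod (apply_bcontfun f (x n))" for n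
      proof -
        have "cmod (apply_bcontfun (f + s n *\<^sub>R h) (x n))
            \<le> cmod (apply_bcontfun f (x n)) + s n * cmod (apply_bcontfun h (x n))"
          using norm_triangle_ineq[of "apply_bcontfun f (x n)" "s n *\<^sub>R apply_bcontfun h (x n)"] s_pos[of n]
          by simp
        also have "s n * cmod (apply_bcontfun h (x n)) \<le> s n * norm h"
          using s_pos[of n] by (intro mult_left_mono norm_bounded) simp
        finally show ?thesis
          using x[of n] Re_add[of n] by linarith
      qed
      then show "\<forall>\<^sub>F n in sequentially.
          1 + s n * Re (\<phi> h) - (s n)\<^sup>2 - s n * norm h \<le> cmod (apply_bcontfun f (x n))"
        by simp
      have "(\<lambda>n. 1 + s n * Re (\<phi> h) - (s n)\<^sup>2 - s n * norm h) \<longlonglongrightarrow> 1 + 0 * Re (\<phi> h) - 0\<^sup>2 - 0 * norm h"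
        by (intro tendsto_intros s0)
      then show "(\<lambda>n. 1 + s n * Re (\<phi> h) - (s n)\<^sup>2 - s n * norm h) \<longlonglongrightarrow> norm f"
        by (simp add: f(2))
    qed (auto intro!: always_eventually norm_bounded)
    have lim: "(\<lambda>n. apply_bcontfun g (x n)) \<longlonglongrightarrow> apply_bcontfun g t" for g :: "'k \<Rightarrow>\<^sub>C complex"
      using continuous_on_tendsto_compose[of UNIV "apply_bcontfun g" x t] \<open>x \<longlonglongrightarrow> t\<close> by simp
    have "(\<lambda>n. Re (cnj (apply_bcontfun f (x n)) * apply_bcontfun h (x n)) + s n * (1 + (norm h)\<^sup>2))
        \<longlonglongrightarrow> Re (cnj (apply_bcontfun f t) * apply_bcontfun h t) + 0 * (1 + (norm h)\<^sup>2)"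
      by (intro tendsto_intros lim s0)
    moreover have "Re (\<phi> h) \<le> Re (cnj (apply_bcontfun f (x n)) * apply_bcontfun h (x n)) + s n * (1 + (norm h)\<^sup>2)" for n
    proof -
      let ?R = "Re (cnj (apply_bcontfun f (x n)) * apply_bcontfun h (x n))"
      have "cmod (apply_bcontfun f (x n) + s n *\<^sub>R apply_bcontfun h (x n))
          \<le> 1 + s n * ?R + (s n)\<^sup>2 * (cmod (apply_bcontfun h (x n)))\<^sup>2"
        using norm_bounded[of f "x n"] f(2) by (intro cmod_add_scaleR_le) simp
      also have "(s n)\<^sup>2 * (cmod (apply_bcontfun h (x n)))\<^sup>2 \<le> (s n)\<^sup>2 * (norm h)\<^sup>2"
        by (intro mult_left_mono power_mono norm_bounded) auto
      finally have "s n * Re (\<phi> h) \<le> s n * ?R + (s n)\<^sup>2 * (norm h)\<^sup>2 + (s n)\<^sup>2"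
        using x[of n] Re_add[of n] by simp
      also have "\<dots> = s n * (?R + s n * (1 + (norm h)\<^sup>2))"
        by (simp add: power2_eq_square algebra_simps)
      finally show ?thesis
        using s_pos[of n] by (simp only: mult_le_cancel_left_pos)
    qed
    ultimately show ?thesis
      using LIMSEQ_le_const by fastforce
  qed
  \<comment> \<open>The scalars 1, -1, \<open>\<i>\<close> and \<open>- \<i>\<close> give both
    inequalities for the real and for the imaginary part.\<close>
  have sc: "Re (c * \<phi> h) \<le> Re (c * (cnj (apply_bcontfun f t) * apply_bcontfun h t))" for c
    using Re_le[OF csubspace_scaleC[OF A h, of c]]
    by (simp add: mult[OF h] apply_bcontfun_scaleC mult.left_commute[of c])
  show ?thesis
    using sc[of 1] sc[of "-1"] sc[of \<i>] sc[of "- \<i>"] by (intro complex_eqI) auto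
qed

text \<open>Uniqueness is \<open>strong_peak_dual_functional\<close>. Existence needs that
  \<open>f\<close> attains its norm at the peak point, which holds because a maximizing sequence
  converges to it.\<close>

lemma strong_peak_functions_sphere_smooth:
  assumes A: "csubspace A"
  shows "strong_peak_functions A \<inter> sphere 0 1 \<subseteq> smooth_points A"
proof
  fix f :: "'a::metric_space \<Rightarrow>\<^sub>C complex" assume "f \<in> strong_peak_functions A \<inter> sphere 0 1"
  then have peak: "f \<in> strong_peak_functions A" and "norm f = 1"
    by auto
  then have f: "f \<in> A" "norm f = 1"
    by (auto simp: strong_peak_functions_def)
  from peak obtain t where t: "\<And>s::nat \<Rightarrow> 'a. (\<lambda>k. cmod (apply_bcontfun f (s k))) \<longlonglongrightarrow> norm f \<Longrightarrow> s \<longlonglongrightarrow> t"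
    unfolding strong_peak_functions_def by blast
  define \<psi> where "\<psi> = restrict (\<lambda>h. cnj (apply_bcontfun f t) * apply_bcontfun h t) A"
  have "cmod (apply_bcontfun f t) = 1"
  proof -
    have "\<exists>x. 1 - inverse (real (Suc n)) < cmod (apply_bcontfun f x)" for n
      using f(2) by (metis bcontfun_cmod_gt diff_less_eq less_add_same_cancel1 inverse_positive_iff_positive of_nat_0_less_iff zero_less_Suc)
    then obtain s where s: "\<And>n. 1 - inverse (real (Suc n)) < cmod (apply_bcontfun f (s n))"
      by metis
    have "(\<lambda>n. 1 - inverse (real (Suc n))) \<longlonglongrightarrow> 1 - 0"
      by (intro tendsto_intros LIMSEQ_inverse_real_of_nat)
    then have "(\<lambda>n. 1 - inverse (real (Suc n))) \<longlonglongrightarrow> norm f"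
      using f(2) by simp
    then have lim: "(\<lambda>n. cmod (apply_bcontfun f (s n))) \<longlonglongrightarrow> norm f"
      by (rule tendsto_sandwich[rotated 2])
        (auto intro!: always_eventually less_imp_le[OF s] norm_bounded simp del: of_nat_Suc)
    have "(\<lambda>n. apply_bcontfun f (s n)) \<longlonglongrightarrow> apply_bcontfun f t"
      using continuous_on_tendsto_compose[of UNIV "apply_bcontfun f" s t] t[OF lim] by simp
    then show ?thesis
      using LIMSEQ_unique[OF tendsto_norm lim] f(2) by simp
  qed
  then have one: "cnj (apply_bcontfun f t) * apply_bcontfun f t = 1" "cmod (cnj (apply_bcontfun f t)) = 1"
    by (simp_all add: mult.commute complex_norm_square[symmetric])
  have "\<psi> \<in> dual_unit_ball A"
    unfolding dual_unit_ball_def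
    using csubspace_add[OF A] csubspace_scaleC[OF A] one(2)
    by (auto simp: \<psi>_def apply_bcontfun_scaleC algebra_simps norm_mult norm_bounded)
  moreover have "Re (\<psi> f) = 1"
    using one by (simp add: \<psi>_def f(1))
  moreover have "\<phi> = \<psi>" if \<phi>: "\<phi> \<in> dual_unit_ball A" "Re (\<phi> f) = 1" for \<phi>
  proof (rule extensionalityI[of _ A])
    show "\<phi> \<in> extensional A" "\<psi> \<in> extensional A"
      using \<phi>(1) by (auto simp: dual_unit_ball_def \<psi>_def)
    show "\<phi> h = \<psi> h" if "h \<in> A" for h
      using strong_peak_dual_functional[OF A f t \<phi> that] that by (simp add: \<psi>_def)
  qed
  ultimately show "f \<in> smooth_points A"
    using f by (auto simp: smooth_points_def)
qed

section \<open>Passage to the unit sphere\<close>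

lemma strong_peak_functions_scaleR:
  assumes A: "csubspace A" and f: "f \<in> strong_peak_functions A" and "r > 0"
  shows "r *\<^sub>R f \<in> strong_peak_functions A"
proof -
  obtain t where t: "\<And>s. (\<lambda>k. cmod (apply_bcontfun f (s k))) \<longlonglongrightarrow> norm f \<Longrightarrow> s \<longlonglongrightarrow> t"
    using f by (auto simp: strong_peak_functions_def)
  have "s \<longlonglongrightarrow> t" if "(\<lambda>k. cmod (apply_bcontfun (r *\<^sub>R f) (s k))) \<longlonglongrightarrow> norm (r *\<^sub>R f)" for s
    using tendsto_mult[OF tendsto_const[of "inverse r"] that] \<open>r > 0\<close>
    by (intro t) (simp add: field_simps)
  then show ?thesis
    using f \<open>r > 0\<close> csubspace_scaleR[OF A] by (auto simp: strong_peak_functions_def)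
qed

text \<open>Strong peak functions are closed under positive scaling, so an approximant in
  \<open>A\<close> can be normalized without leaving them.\<close>

lemma dense_gdelta_strong_peak_sphere:
  assumes A: "csubspace A" and dense: "dense_gdelta_in (top_of_set A) (strong_peak_functions A)"
  shows "dense_gdelta_in (top_of_set (A \<inter> sphere 0 1)) (strong_peak_functions A \<inter> sphere 0 1)"
  unfolding dense_gdelta_in_def
proof
  have sub: "strong_peak_functions A \<subseteq> A"
    by (auto simp: strong_peak_functions_def)
  have "gdelta_in (subtopology (top_of_set A) (sphere 0 1)) (strong_peak_functions A \<inter> sphere 0 1)"
    using dense unfolding dense_gdelta_in_def gdelta_in_subtopology[of "top_of_set A"] by blast
  then show "gdelta_in (top_of_set (A \<inter> sphere 0 1)) (strong_peak_functions A \<inter> sphere 0 1)"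
    by (simp add: subtopology_subtopology)
  have "\<exists>g\<in>strong_peak_functions A \<inter> sphere 0 1. dist g f < e"
    if f: "f \<in> A \<inter> sphere 0 1" and e: "e > 0" for f and e :: real
  proof -
    obtain g where g: "g \<in> strong_peak_functions A" "dist g f < e / 2"
      using dense f e top_of_set_dense_iff[OF sub] unfolding dense_gdelta_in_def
      by (metis IntD1 half_gt_zero topspace_euclidean_subtopology)
    \<comment> \<open>Normalizing moves \<open>g\<close> by the difference of \<open>norm g\<close>
      and \<open>norm f = 1\<close>, which is at most \<open>dist g f\<close>; hence the
      \<open>e / 2\<close> above.\<close>
    define k where "k = inverse (norm g) *\<^sub>R g"
    have pos: "norm g > 0"
      using g(1) by (auto simp: strong_peak_functions_def)
    have "k - g = (inverse (norm g) - 1) *\<^sub>R g"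
      by (simp add: k_def algebra_simps)
    then have "norm (k - g) = \<bar>inverse (norm g) - 1\<bar> * norm g"
      by simp
    also have "\<dots> = \<bar>(inverse (norm g) - 1) * norm g\<bar>"
      by (simp add: abs_mult)
    also have "\<dots> = \<bar>norm f - norm g\<bar>"
      using pos f by (simp add: algebra_simps)
    also have "\<dots> \<le> dist g f"
      by (simp add: dist_norm norm_triangle_ineq3 abs_minus_commute[of "norm f"])
    finally have "dist k f < e"
      using g(2) dist_triangle[of k f g] by (simp add: dist_norm)
    moreover have "k \<in> strong_peak_functions A"
      unfolding k_def using strong_peak_functions_scaleR[OF A g(1)] pos by simp
    moreover have "norm k = 1"
      using pos by (simp add: k_def)
    ultimately show ?thesis
      by auto
  qed
  moreover have "strong_peak_functions A \<inter> sphere 0 1 \<subseteq> A \<inter> sphere 0 1"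
    using sub by blast
  ultimately show "top_of_set (A \<inter> sphere 0 1) closure_of (strong_peak_functions A \<inter> sphere 0 1)
      = topspace (top_of_set (A \<inter> sphere 0 1))"
    by (simp add: top_of_set_dense_iff)
qed

section \<open>Holomorphic functions on the unit ball\<close>

text \<open>A unit vector is not interior: stretched by \<open>1 + e / 2\<close> it stays in the
  \<open>e\<close>-ball around itself but leaves the closed unit ball.\<close>

lemma interior_unit_cball: "interior (cball (0::'a::real_normed_vector) 1) = ball 0 1"
proof
  show "ball (0::'a) 1 \<subseteq> interior (cball 0 1)"
    by (intro interior_maximal ball_subset_cball open_ball)
  show "interior (cball (0::'a) 1) \<subseteq> ball 0 1"
  proof
    fix x :: 'a assume "x \<in> interior (cball 0 1)"
    then obtain e where e: "e > 0" "ball x e \<subseteq> cball 0 1"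
      by (auto simp: mem_interior)
    then have x: "norm x \<le> 1"
      using centre_in_ball by fastforce
    have "dist x ((1 + e / 2) *\<^sub>R x) = e / 2 * norm x"
      using e(1) by (simp add: dist_norm algebra_simps)
    also have "\<dots> < e"
      using x e(1) mult_left_mono[OF x, of "e / 2"] by simp
    finally have "norm ((1 + e / 2) *\<^sub>R x) \<le> 1"
      using e(2) by (force simp: subset_iff)
    then have "norm x \<noteq> 1"
      using e(1) by auto
    with x show "x \<in> ball 0 1" by simp
  qed
qed

section \<open>The closed unit ball as a complete metric space\<close>

lemma norm_of_unit_ball: "norm (of_unit_ball s) \<le> 1"
  using of_unit_ball[of s] by simp

lemma of_unit_ball_to_unit_ball: "norm x \<le> 1 \<Longrightarrow> of_unit_ball (to_unit_ball x) = x"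
  by (rule to_unit_ball_inverse) simp

text \<open>Supplies the limit of the centres in
  \<open>strong_peak_functions_eq_Inter\<close>.\<close>

instance unit_ball :: (banach) complete_space
proof
  fix X :: "nat \<Rightarrow> 'a unit_ball" assume "Cauchy X"
  then have "Cauchy (\<lambda>n. of_unit_ball (X n))"
    by (simp add: Cauchy_def dist_unit_ball_def)
  then obtain l where l: "(\<lambda>n. of_unit_ball (X n)) \<longlonglongrightarrow> l"
    using Cauchy_convergent by (auto simp: convergent_def)
  have "l \<in> cball 0 1"
    using closed_sequentially[OF closed_cball _ l] of_unit_ball by blast
  then have "of_unit_ball (to_unit_ball l) = l"
    by (intro of_unit_ball_to_unit_ball) simp
  with l have "X \<longlonglongrightarrow> to_unit_ball l"
    by (simp add: tendsto_iff dist_unit_ball_def)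
  then show "convergent X"
    by (auto simp: convergent_def)
qed

lemma continuous_on_to_unit_ball: "continuous_on (cball 0 1) to_unit_ball"
  unfolding continuous_on_iff by (auto simp: dist_unit_ball_def of_unit_ball_to_unit_ball)

abbreviation ball_fun :: "('a::real_normed_vector unit_ball \<Rightarrow>\<^sub>C complex) \<Rightarrow> 'a \<Rightarrow> complex"
  where "ball_fun f x \<equiv> apply_bcontfun f (to_unit_ball x)"

lemma continuous_on_ball_fun: "continuous_on (cball 0 1) (ball_fun f)"
  by (rule continuous_on_compose2[OF _ continuous_on_to_unit_ball, of UNIV]) auto

lemma mem_A_b_iff:
  "f \<in> A_b \<longleftrightarrow> (\<forall>x. norm x < 1 \<longrightarrow>
    (\<exists>D. (ball_fun f has_derivative D) (at x) \<and> (\<forall>c v. D (c *\<^sub>C v) = c * D v)))"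
  by (auto simp: A_b_def cfrechet_holomorphic_on_def interior_unit_cball)

section \<open>Slices along complex lines and Cauchy estimates\<close>

lemma bounded_linear_scaleC_left: "bounded_linear (\<lambda>c. c *\<^sub>C v)"
proof (rule bounded_linear_intro)
  fix c d :: complex and r :: real
  show "(c + d) *\<^sub>C v = c *\<^sub>C v + d *\<^sub>C v"
    by (rule scaleC_add_left)
  show "(r *\<^sub>R c) *\<^sub>C v = r *\<^sub>R c *\<^sub>C v"
    by (simp add: scaleR_conv_of_real scaleC_scaleC[symmetric] scaleC_of_real)
  show "norm (c *\<^sub>C v) \<le> norm c * norm v"
    by (simp add: norm_scaleC)
qed

text \<open>Membership gives some complex homogeneous derivative; by uniqueness, any derivative
  chosen at the point is that one.\<close>

lemma A_b_derivative_scaleC: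
  assumes "f \<in> A_b" "norm x < 1" "(ball_fun f has_derivative D) (at x)"
  shows "D (c *\<^sub>C v) = c * D v"
  using assms has_derivative_unique unfolding mem_A_b_iff by metis

text \<open>Complex homogeneity turns the real derivative
  \<open>\<lambda>w. D (w *\<^sub>C v)\<close> of the slice into multiplication by
  \<open>D v\<close>.\<close>

lemma A_b_slice_has_field_derivative:
  assumes f: "f \<in> A_b" and x: "norm (x + z *\<^sub>C v) < 1"
    and D: "(ball_fun f has_derivative D) (at (x + z *\<^sub>C v))"
  shows "((\<lambda>w. ball_fun f (x + w *\<^sub>C v)) has_field_derivative D v) (at z)"
proof -
  have "((\<lambda>w. x + w *\<^sub>C v) has_derivative (\<lambda>w. w *\<^sub>C v)) (at z)"
    by (auto intro!: derivative_eq_intros bounded_linear.has_derivative[OF bounded_linear_scaleC_left])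
  then have "((\<lambda>w. ball_fun f (x + w *\<^sub>C v)) has_derivative (\<lambda>w. D (w *\<^sub>C v))) (at z)"
    by (rule has_derivative_compose) (rule D)
  then show ?thesis
    using A_b_derivative_scaleC[OF f x D]
    by (simp add: has_field_derivative_def mult.commute[of _ "D v"])
qed

text \<open>The condition on \<open>R\<close> sends the open disc into the open ball, where
  \<open>f\<close> is differentiable, and the closed disc into the closed ball, where
  \<open>f\<close> is continuous. Cauchy's inequality and the maximum modulus principle use
  both.\<close>

lemma
  assumes f: "f \<in> A_b" and "v \<noteq> 0" and R: "norm x + R * norm v \<le> 1"
  shows A_b_slice_holomorphic: "(\<lambda>w. ball_fun f (x + w *\<^sub>C v)) holomorphic_on ball 0 R"
    and A_b_slice_continuous: "continuous_on (cball 0 R) (\<lambda>w. ball_fun f (x + w *\<^sub>C v))"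
proof -
  show "(\<lambda>w. ball_fun f (x + w *\<^sub>C v)) holomorphic_on ball 0 R"
    unfolding holomorphic_on_open[OF open_ball]
  proof (intro ballI)
    fix z :: complex assume "z \<in> ball 0 R"
    then have "cmod z * norm v < R * norm v"
      using \<open>v \<noteq> 0\<close> by simp
    then have "norm (x + z *\<^sub>C v) < 1"
      using R norm_triangle_ineq[of x "z *\<^sub>C v"] unfolding norm_scaleC by linarith
    then show "\<exists>f'. ((\<lambda>w. ball_fun f (x + w *\<^sub>C v)) has_field_derivative f') (at z)"
      using f A_b_slice_has_field_derivative[OF f] unfolding mem_A_b_iff by blast
  qed
  show "continuous_on (cball 0 R) (\<lambda>w. ball_fun f (x + w *\<^sub>C v))"
  proof (rule continuous_on_compose2[OF continuous_on_ball_fun])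
    show "continuous_on (cball 0 R) (\<lambda>w. x + w *\<^sub>C v)"
      by (intro continuous_intros bounded_linear.continuous_on[OF bounded_linear_scaleC_left])
    show "(\<lambda>w. x + w *\<^sub>C v) ` cball 0 R \<subseteq> cball 0 1"
    proof clarsimp
      fix w :: complex assume "cmod w \<le> R"
      then show "norm (x + w *\<^sub>C v) \<le> 1"
        using R norm_triangle_ineq[of x "w *\<^sub>C v"] mult_right_mono[of "cmod w" R "norm v"]
        by (simp add: norm_scaleC)
    qed
  qed
qed

text \<open>Cauchy's inequality on the slice in direction \<open>v\<close>, with the largest radius
  that the slice lemmas admit.\<close>

lemma A_b_derivative_bound:
  assumes f: "f \<in> A_b" and x: "norm x < 1" and D: "(ball_fun f has_derivative D) (at x)"
  shows "cmod (D v) \<le> norm f / (1 - norm x) * norm v"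
proof (cases "v = 0")
  case True
  then show ?thesis
    using linear_0[OF has_derivative_linear[OF D]] by simp
next
  case False
  define R where "R = (1 - norm x) / norm v"
  have R: "R > 0" "norm x + R * norm v \<le> 1"
    using x False by (auto simp: R_def)
  have "((\<lambda>w. ball_fun f (x + w *\<^sub>C v)) has_field_derivative D v) (at 0)"
    using x D by (intro A_b_slice_has_field_derivative[OF f]) simp_all
  then have "deriv (\<lambda>w. ball_fun f (x + w *\<^sub>C v)) 0 = D v"
    by (rule DERIV_imp_deriv)
  moreover have "cmod ((deriv ^^ 1) (\<lambda>w. ball_fun f (x + w *\<^sub>C v)) 0) \<le> fact 1 * norm f / R ^ 1"
    using A_b_slice_holomorphic[OF f False R(2)] A_b_slice_continuous[OF f False R(2)] R(1)
    by (rule Cauchy_inequality) (rule norm_bounded)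
  ultimately show ?thesis
    by (simp add: R_def)
qed

section \<open>Both function spaces are closed complex subspaces\<close>

lemma csubspace_A_b: "csubspace A_b"
  unfolding csubspace_def
proof (intro conjI ballI allI)
  fix f g :: "'a unit_ball \<Rightarrow>\<^sub>C complex" assume fg: "f \<in> A_b" "g \<in> A_b"
  show "f + g \<in> A_b"
    unfolding mem_A_b_iff
  proof (intro allI impI)
    fix x :: 'a assume x: "norm x < 1"
    then obtain D E where "(ball_fun f has_derivative D) (at x)" "\<And>c v. D (c *\<^sub>C v) = c * D v"
      "(ball_fun g has_derivative E) (at x)" "\<And>c v. E (c *\<^sub>C v) = c * E v"
      using fg unfolding mem_A_b_iff by metis
    then show "\<exists>D. (ball_fun (f + g) has_derivative D) (at x) \<and> (\<forall>c v. D (c *\<^sub>C v) = c * D v)"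
      by (intro exI[of _ "\<lambda>v. D v + E v"]) (auto intro!: has_derivative_add simp: algebra_simps)
  qed
next
  fix a and f :: "'a unit_ball \<Rightarrow>\<^sub>C complex" assume f: "f \<in> A_b"
  show "a *\<^sub>C f \<in> A_b"
    unfolding mem_A_b_iff
  proof (intro allI impI)
    fix x :: 'a assume x: "norm x < 1"
    then obtain D where "(ball_fun f has_derivative D) (at x)" "\<And>c v. D (c *\<^sub>C v) = c * D v"
      using f unfolding mem_A_b_iff by metis
    then show "\<exists>D. (ball_fun (a *\<^sub>C f) has_derivative D) (at x) \<and> (\<forall>c v. D (c *\<^sub>C v) = c * D v)"
      by (intro exI[of _ "\<lambda>v. a * D v"])
        (auto intro!: has_derivative_mult_right simp: apply_bcontfun_scaleC)
  qed
qed

lemma csubspace_A_u: "csubspace A_u"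
  unfolding csubspace_def
proof (intro conjI ballI allI)
  fix f g :: "'a unit_ball \<Rightarrow>\<^sub>C complex" and c
  assume f: "f \<in> A_u"
  show "c *\<^sub>C f \<in> A_u"
    using f csubspace_scaleC[OF csubspace_A_b, of f c]
      bounded_linear.uniformly_continuous_on[OF bounded_linear_mult_right, of UNIV "apply_bcontfun f" c]
    by (simp add: A_u_def apply_bcontfun_scaleC[abs_def])
  assume "g \<in> A_u"
  with f show "f + g \<in> A_u"
    using csubspace_add[OF csubspace_A_b, of f g]
      uniformly_continuous_on_add[of UNIV "apply_bcontfun f" "apply_bcontfun g"]
    by (simp add: A_u_def)
qed

lemma has_derivative_diff_A_b:
  assumes "(ball_fun f has_derivative D) (at x)" "(ball_fun g has_derivative E) (at x)"
  shows "(ball_fun (f - g) has_derivative (\<lambda>v. D v - E v)) (at x)"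
  using has_derivative_diff[OF assms] by simp

text \<open>By the Cauchy estimates, uniform convergence passes to the derivatives on smaller balls.\<close>

lemma closed_A_b: "closed (A_b :: ('a::complex_normed_vector unit_ball \<Rightarrow>\<^sub>C complex) set)"
  unfolding closed_sequential_limits
proof (intro allI impI)
  fix F :: "nat \<Rightarrow> 'a unit_ball \<Rightarrow>\<^sub>C complex" and f
  assume "(\<forall>n. F n \<in> A_b) \<and> F \<longlonglongrightarrow> f"
  then have F: "\<And>n. F n \<in> A_b" and lim: "F \<longlonglongrightarrow> f"
    by auto
  have "\<forall>n. \<forall>x. \<exists>D. norm x < 1 \<longrightarrow> (ball_fun (F n) has_derivative D) (at x)"
    using F unfolding mem_A_b_iff by metis
  then obtain E where E: "\<And>n x. norm x < 1 \<Longrightarrow> (ball_fun (F n) has_derivative E n x) (at x)"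
    by metis
  have diff: "F n - F m \<in> A_b" for m n
    using csubspace_add[OF csubspace_A_b F csubspace_scaleR[OF csubspace_A_b F], of n "-1" m] by simp
  have E_diff: "cmod (E n x v - E m x v) \<le> norm (F n - F m) / (1 - norm x) * norm v"
    if "norm x < 1" for m n x v
    by (rule A_b_derivative_bound[OF diff that has_derivative_diff_A_b[OF E E]]) (use that in auto)
  show "f \<in> A_b"
    unfolding mem_A_b_iff
  proof (intro allI impI)
    fix x0 :: 'a assume x0: "norm x0 < 1"
    \<comment> \<open>A radius strictly between \<open>norm x0\<close> and 1, within which the
      factor \<open>1 / (1 - norm x)\<close> stays bounded.\<close>
    define \<rho> where "\<rho> = (norm x0 + 1) / 2"
    have \<rho>: "norm x0 < \<rho>" "\<rho> < 1"
      using x0 by (auto simp: \<rho>_def)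
    have unif: "\<exists>N. \<forall>m\<ge>N. \<forall>n\<ge>N. \<forall>x\<in>ball 0 \<rho>. \<forall>v. cmod (E n x v - E m x v) \<le> e * norm v"
      if "e > 0" for e
    proof -
      have "e * (1 - \<rho>) > 0"
        using that \<rho> by simp
      then obtain N where N: "\<And>m n. m \<ge> N \<Longrightarrow> n \<ge> N \<Longrightarrow> norm (F n - F m) < e * (1 - \<rho>)"
        using LIMSEQ_imp_Cauchy[OF lim] unfolding Cauchy_iff by metis
      have "cmod (E n x v - E m x v) \<le> e * norm v" if "m \<ge> N" "n \<ge> N" "x \<in> ball 0 \<rho>" for m n x v
      proof -
        have x: "norm x < \<rho>" using that by simp
        have "norm (F n - F m) \<le> e * (1 - \<rho>)"
          using N[OF that(1,2)] by simp
        also have "\<dots> \<le> e * (1 - norm x)"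
          using x \<open>e > 0\<close> by simp
        finally have "norm (F n - F m) / (1 - norm x) \<le> e"
          using x \<rho> by (simp add: field_simps)
        then have "norm (F n - F m) / (1 - norm x) * norm v \<le> e * norm v"
          by (rule mult_right_mono) simp
        with E_diff[of x n v m] x \<rho> show ?thesis
          by linarith
      qed
      then show ?thesis by blast
    qed
    have "convergent (\<lambda>n. E n x v)" if "x \<in> ball 0 \<rho>" for x v
    proof (rule Cauchy_convergent, unfold Cauchy_iff, intro allI impI)
      fix e :: real assume "e > 0"
      \<comment> \<open>The added 1 avoids a zero denominator at \<open>v = 0\<close> and makes the
        final estimate strict.\<close>
      then have "e / (norm v + 1) > 0"
        by (intro divide_pos_pos) (auto simp: add_nonneg_pos)
      from unif[OF this] obtain N where "\<forall>m\<ge>N. \<forall>n\<ge>N. \<forall>x\<in>ball 0 \<rho>. \<forall>v'.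
          cmod (E n x v' - E m x v') \<le> e / (norm v + 1) * norm v'" ..
      then have N: "cmod (E n x v - E m x v) \<le> e / (norm v + 1) * norm v" if "m \<ge> N" "n \<ge> N" for m n
        using that \<open>x \<in> ball 0 \<rho>\<close> by blast
      have "e / (norm v + 1) * norm v < e"
      proof -
        have "0 < norm v + 1"
          using norm_ge_zero[of v] by linarith
        then show ?thesis
          using \<open>e > 0\<close> by (simp add: field_simps)
      qed
      then have "cmod (E m x v - E n x v) < e" if "m \<ge> N" "n \<ge> N" for m n
        using N[OF that(2,1)] by (rule le_less_trans[rotated])
      then show "\<exists>N. \<forall>m\<ge>N. \<forall>n\<ge>N. cmod (E m x v - E n x v) < e"
        by blast
    qed
    then obtain G where G: "\<And>x v. x \<in> ball 0 \<rho> \<Longrightarrow> (\<lambda>n. E n x v) \<longlonglongrightarrow> G x v"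
      unfolding convergent_def by metis
    have "\<exists>g. \<forall>x\<in>ball 0 \<rho>. (\<lambda>n. ball_fun (F n) x) \<longlonglongrightarrow> g x \<and> (g has_derivative G x) (at x within ball 0 \<rho>)"
    proof (rule has_derivative_sequence)
      show "(ball_fun (F n) has_derivative E n x) (at x within ball 0 \<rho>)" if "x \<in> ball 0 \<rho>" for n x
        using E[of x n] that \<rho> has_derivative_at_withinI by force
      show "\<forall>\<^sub>F n in sequentially. \<forall>x\<in>ball 0 \<rho>. \<forall>h. cmod (E n x h - G x h) \<le> e * norm h"
        if "e > 0" for e
      proof -
        obtain N where N: "\<And>m n x v. m \<ge> N \<Longrightarrow> n \<ge> N \<Longrightarrow> x \<in> ball 0 \<rho> \<Longrightarrow>
            cmod (E n x v - E m x v) \<le> e * norm v"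
          using unif[OF \<open>e > 0\<close>] by blast
        \<comment> \<open>Letting \<open>m\<close> tend to infinity in the Cauchy bound gives
          convergence to \<open>G\<close> uniformly in \<open>x\<close>.\<close>
        have "cmod (E n x h - G x h) \<le> e * norm h" if "n \<ge> N" "x \<in> ball 0 \<rho>" for n x h
        proof (rule LIMSEQ_le_const2)
          show "(\<lambda>m. cmod (E n x h - E m x h)) \<longlonglongrightarrow> cmod (E n x h - G x h)"
            by (intro tendsto_intros G that)
          show "\<exists>N. \<forall>m\<ge>N. cmod (E n x h - E m x h) \<le> e * norm h"
            using N that by blast
        qed
        then show ?thesis
          unfolding eventually_sequentially by blast
      qed
      show "x0 \<in> ball 0 \<rho>"
        using \<rho> by simp
      show "(\<lambda>n. ball_fun (F n) x0) \<longlonglongrightarrow> ball_fun f x0"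
        using tendsto_bcontfun_uniform_limit[OF lim] by (rule tendsto_uniform_limitI) simp
    qed simp
    then obtain g where g: "\<And>x. x \<in> ball 0 \<rho> \<Longrightarrow> (\<lambda>n. ball_fun (F n) x) \<longlonglongrightarrow> g x"
      "\<And>x. x \<in> ball 0 \<rho> \<Longrightarrow> (g has_derivative G x) (at x within ball 0 \<rho>)"
      by blast
    \<comment> \<open>The limit function obtained from \<open>has_derivative_sequence\<close> is the
      given uniform limit.\<close>
    have g_eq: "g x = ball_fun f x" if "x \<in> ball 0 \<rho>" for x
      using g(1)[OF that] tendsto_uniform_limitI[OF tendsto_bcontfun_uniform_limit[OF lim], of "to_unit_ball x"]
      by (intro LIMSEQ_unique) auto
    have x0': "x0 \<in> ball 0 \<rho>"
      using \<rho> by simp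
    have "(ball_fun f has_derivative G x0) (at x0)"
      using has_derivative_transform_within_open[of g "G x0" x0 UNIV "ball 0 \<rho>" "ball_fun f"]
        g(2)[OF x0'] g_eq x0' by (simp add: at_within_open[OF x0'])
    moreover have "G x0 (c *\<^sub>C v) = c * G x0 v" for c v
    proof (rule LIMSEQ_unique)
      show "(\<lambda>n. E n x0 (c *\<^sub>C v)) \<longlonglongrightarrow> G x0 (c *\<^sub>C v)"
        by (rule G[OF x0'])
      show "(\<lambda>n. E n x0 (c *\<^sub>C v)) \<longlonglongrightarrow> c * G x0 v"
        using tendsto_mult[OF tendsto_const G[OF x0']] A_b_derivative_scaleC[OF F x0 E[OF x0]]
        by simp
    qed
    ultimately show "\<exists>D. (ball_fun f has_derivative D) (at x0) \<and> (\<forall>c v. D (c *\<^sub>C v) = c * D v)"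
      by blast
  qed
qed

text \<open>The oscillation of \<open>f\<close> is estimated through an approximant
  \<open>g\<close>: two approximation errors and one oscillation of \<open>g\<close>, each below
  \<open>e / 3\<close>.\<close>

lemma closed_uniformly_continuous_bcontfun:
  "closed {f :: 'a::metric_space \<Rightarrow>\<^sub>C 'b::metric_space. uniformly_continuous_on UNIV (apply_bcontfun f)}"
  unfolding closure_subset_eq[symmetric]
proof (intro subsetI CollectI)
  fix f :: "'a \<Rightarrow>\<^sub>C 'b"
  assume "f \<in> closure {f. uniformly_continuous_on UNIV (apply_bcontfun f)}"
  then have approx: "\<forall>e>0. \<exists>g\<in>{g. uniformly_continuous_on UNIV (apply_bcontfun g)}. dist g f < e"
    by (simp only: closure_approachable)
  show "uniformly_continuous_on UNIV (apply_bcontfun f)"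
    unfolding uniformly_continuous_on_def
  proof (intro allI impI)
    fix e :: real assume "e > 0"
    then obtain g where g: "uniformly_continuous_on UNIV (apply_bcontfun g)" "dist g f < e / 3"
      using approx by (metis mem_Collect_eq zero_less_divide_iff zero_less_numeral)
    then obtain d where d: "d > 0" "\<And>x y. dist y x < d \<Longrightarrow> dist (apply_bcontfun g y) (apply_bcontfun g x) < e / 3"
      using \<open>e > 0\<close> unfolding uniformly_continuous_on_def
      by (metis UNIV_I zero_less_divide_iff zero_less_numeral)
    have "dist (apply_bcontfun f y) (apply_bcontfun f x) < e" if "dist y x < d" for x y
      using d(2)[OF that] dist_fun_lt_imp_dist_val_lt[OF g(2), of x] dist_fun_lt_imp_dist_val_lt[OF g(2), of y]
        dist_triangle_third[of "apply_bcontfun f y" "apply_bcontfun g y" e "apply_bcontfun g x" "apply_bcontfun f x"]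
      by (simp add: dist_commute)
    with d(1) show "\<exists>d>0. \<forall>x\<in>UNIV. \<forall>y\<in>UNIV. dist y x < d \<longrightarrow> dist (apply_bcontfun f y) (apply_bcontfun f x) < e"
      by blast
  qed
qed

lemma closed_A_u: "closed (A_u :: ('a::complex_normed_vector unit_ball \<Rightarrow>\<^sub>C complex) set)"
proof -
  have "A_u = A_b \<inter> {f :: 'a unit_ball \<Rightarrow>\<^sub>C complex. uniformly_continuous_on UNIV (apply_bcontfun f)}"
    by (auto simp: A_u_def)
  then show ?thesis
    using closed_Int[OF closed_A_b closed_uniformly_continuous_bcontfun] by (rule ssubst)
qed

section \<open>Peaks on the unit sphere\<close>

text \<open>A near-maximizer in the ball lies on a complex disc centred at the origin whose boundary
  is in the unit sphere; by the maximum modulus principle \<open>c\<close> is exceeded on that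
  boundary too.\<close>

lemma A_b_norm_gt_on_sphere:
  fixes f :: "'a::complex_normed_vector unit_ball \<Rightarrow>\<^sub>C complex"
  assumes f: "f \<in> A_b" and c: "c < norm f" and nontrivial: "\<exists>x::'a. x \<noteq> 0"
  obtains x where "norm x = 1" "c < cmod (ball_fun f x)"
proof -
  obtain s where s: "c < cmod (apply_bcontfun f s)"
    using c by (rule bcontfun_cmod_gt)
  define p where "p = of_unit_ball s"
  have p: "norm p \<le> 1" "ball_fun f p = apply_bcontfun f s"
    by (simp_all add: p_def norm_of_unit_ball of_unit_ball_inverse)
  \<comment> \<open>At the origin every unit vector will do, and \<open>nontrivial\<close> provides
    one.\<close>
  obtain w where w: "norm w = 1" "complex_of_real (norm p) *\<^sub>C w = p"
  proof (cases "p = 0")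
    case True
    obtain x :: 'a where "x \<noteq> 0" using nontrivial by blast
    then show thesis
      using True by (intro that[of "inverse (norm x) *\<^sub>R x"]) (auto simp: scaleC_of_real)
  next
    case False
    then show thesis
      by (intro that[of "inverse (norm p) *\<^sub>R p"]) (auto simp: scaleC_of_real)
  qed
  have "w \<noteq> 0" "norm (0::'a) + 1 * norm w \<le> 1"
    using w(1) by auto
  note slice = A_b_slice_holomorphic[OF f this] A_b_slice_continuous[OF f this]
  have "\<exists>z. cmod z = 1 \<and> c < cmod (ball_fun f (z *\<^sub>C w))"
  proof (rule ccontr)
    assume neg: "\<nexists>z. cmod z = 1 \<and> c < cmod (ball_fun f (z *\<^sub>C w))"
    \<comment> \<open>The summand 0 keeps the form \<open>x + w *\<^sub>C v\<close> of the slice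
      lemmas; the disc point \<open>norm p\<close> is mapped to \<open>p\<close>.\<close>
    have "cmod (ball_fun f (0 + complex_of_real (norm p) *\<^sub>C w)) \<le> c"
    proof (rule maximum_modulus_frontier[where f = "\<lambda>z. ball_fun f (0 + z *\<^sub>C w)"
          and S = "cball 0 1" and \<xi> = "complex_of_real (norm p)"])
      show "(\<lambda>z. ball_fun f (0 + z *\<^sub>C w)) holomorphic_on interior (cball 0 1)"
        using slice(1) by (simp only: interior_cball)
      show "continuous_on (closure (cball 0 1)) (\<lambda>z. ball_fun f (0 + z *\<^sub>C w))"
        using slice(2) by (simp only: closure_closed closed_cball)
      show "cmod (ball_fun f (0 + z *\<^sub>C w)) \<le> c" if "z \<in> frontier (cball 0 1)" for z
        using neg that by (auto simp: not_less)
      show "complex_of_real (norm p) \<in> cball 0 1"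
        using p(1) by simp
    qed simp
    with s show False
      by (simp add: w(2) p(2))
  qed
  then obtain z where "cmod z = 1" "c < cmod (ball_fun f (z *\<^sub>C w))"
    by blast
  then show thesis
    using w(1) by (intro that[of "z *\<^sub>C w"]) (auto simp: norm_scaleC)
qed

text \<open>A contractive linear \<open>F\<close> sends the ball into the closed unit disc, where
  \<open>(1 + z) / 2\<close> has modulus 1 only at \<open>z = 1\<close>; powers sharpen this peak.
  \<open>apply_peak_fun\<close> justifies \<open>Bcontfun\<close> for such \<open>F\<close>.\<close>

definition peak_fun :: "('a::complex_normed_vector \<Rightarrow> complex) \<Rightarrow> nat \<Rightarrow> ('a unit_ball \<Rightarrow>\<^sub>C complex)"
  where "peak_fun F m = Bcontfun (\<lambda>s. ((1 + F (of_unit_ball s)) / 2) ^ m)"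

lemma half_one_add_le:
  assumes "\<And>y. cmod (F y) \<le> norm y"
  shows "cmod ((1 + F (of_unit_ball s)) / 2) \<le> 1"
  using norm_triangle_ineq[of 1 "F (of_unit_ball s)"] order_trans[OF assms[of "of_unit_ball s"] norm_of_unit_ball[of s]]
  by (simp add: norm_divide)

text \<open>On the closed unit disc the power \<open>m\<close> is Lipschitz with constant
  \<open>m\<close>, and \<open>(1 + F y) / 2\<close> does not increase distances.\<close>

lemma uniformly_continuous_peak_fun:
  assumes F: "clinear_functional F" "\<And>y. cmod (F y) \<le> norm y"
  shows "uniformly_continuous_on UNIV (\<lambda>s. ((1 + F (of_unit_ball s)) / 2) ^ m)"
  unfolding uniformly_continuous_on_def
proof (intro allI impI)
  fix e :: real assume e: "e > 0"
  have Fdiff: "F x - F y = F (x - y)" for x y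
    using F(1) unfolding clinear_functional_def by (metis add_diff_cancel_right' diff_add_cancel)
  have le: "dist (((1 + F (of_unit_ball s)) / 2) ^ m) (((1 + F (of_unit_ball t)) / 2) ^ m) \<le> m * dist s t" for s t
  proof -
    let ?a = "(1 + F (of_unit_ball s)) / 2" and ?b = "(1 + F (of_unit_ball t)) / 2"
    have "cmod (?a ^ m - ?b ^ m) \<le> m * cmod (?a - ?b)"
      by (intro norm_power_diff half_one_add_le F)
    also have "cmod (?a - ?b) = cmod (F (of_unit_ball s - of_unit_ball t)) / 2"
      by (simp add: Fdiff[symmetric] diff_divide_distrib[symmetric] norm_divide)
    also have "\<dots> \<le> dist s t"
      using F(2)[of "of_unit_ball s - of_unit_ball t"] norm_ge_zero[of "of_unit_ball s - of_unit_ball t"]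
      unfolding dist_unit_ball_def dist_norm by linarith
    finally show ?thesis
      by (simp add: dist_norm mult_left_mono)
  qed
  \<comment> \<open>Dividing by \<open>m + 1\<close> also covers the exponent 0, which occurs for
    the zero space.\<close>
  have "dist (((1 + F (of_unit_ball s)) / 2) ^ m) (((1 + F (of_unit_ball t)) / 2) ^ m) < e"
    if "dist s t < e / (real m + 1)" for s t
  proof -
    have "real m * dist s t \<le> (real m + 1) * dist s t"
      by (simp add: algebra_simps)
    also have "\<dots> < e"
      using that by (simp add: field_simps)
    finally show ?thesis
      using le[of s t] by linarith
  qed
  then show "\<exists>d>0. \<forall>s\<in>UNIV. \<forall>t\<in>UNIV. dist t s < d \<longrightarrow>
      dist (((1 + F (of_unit_ball t)) / 2) ^ m) (((1 + F (of_unit_ball s)) / 2) ^ m) < e"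
    using e by (intro exI[of _ "e / (real m + 1)"]) auto
qed

lemma apply_peak_fun:
  assumes F: "clinear_functional F" "\<And>y. cmod (F y) \<le> norm y"
  shows "apply_bcontfun (peak_fun F m) = (\<lambda>s. ((1 + F (of_unit_ball s)) / 2) ^ m)"
  unfolding peak_fun_def
proof (intro Bcontfun_inverse bcontfun_normI)
  show "continuous_on UNIV (\<lambda>s. ((1 + F (of_unit_ball s)) / 2) ^ m)"
    by (intro uniformly_continuous_imp_continuous uniformly_continuous_peak_fun F)
  show "cmod (((1 + F (of_unit_ball s)) / 2) ^ m) \<le> 1" for s
    unfolding norm_power by (intro power_le_one half_one_add_le F norm_ge_zero)
qed

lemma norm_peak_fun_le:
  assumes F: "clinear_functional F" "\<And>y. cmod (F y) \<le> norm y"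
  shows "norm (peak_fun F m) \<le> 1"
proof (rule norm_bound)
  show "cmod (apply_bcontfun (peak_fun F m) s) \<le> 1" for s
    unfolding apply_peak_fun[OF F] norm_power by (intro power_le_one half_one_add_le F norm_ge_zero)
qed

lemma clinear_functional_bounded_linear:
  assumes F: "clinear_functional F" "\<And>y. cmod (F y) \<le> norm y"
  shows "bounded_linear F"
proof (rule bounded_linear_intro[of _ 1])
  show "F (x + y) = F x + F y" for x y
    using F(1) by (simp add: clinear_functional_def)
  show "F (r *\<^sub>R x) = r *\<^sub>R F x" for r x
    using F(1) unfolding clinear_functional_def by (metis scaleC_of_real scaleR_conv_of_real)
  show "cmod (F x) \<le> norm x * 1" for x
    using F(2) by simp
qed

text \<open>A polynomial in one complex variable is composed with a bounded complex linear
  functional, so the chain rule gives a multiple of \<open>F\<close> as derivative.\<close>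

lemma peak_fun_in_A_u:
  assumes F: "clinear_functional F" "\<And>y. cmod (F y) \<le> norm y"
  shows "peak_fun F m \<in> A_u"
proof -
  have "peak_fun F m \<in> A_b"
    unfolding mem_A_b_iff
  proof (intro allI impI)
    fix x :: 'a assume x: "norm x < 1"
    have "(\<lambda>z. ((1 + z) / 2) ^ m) holomorphic_on UNIV"
      by (intro holomorphic_intros) simp
    then obtain c where "((\<lambda>z. ((1 + z) / 2) ^ m) has_field_derivative c) (at (F x))"
      using holomorphic_on_open[OF open_UNIV] by blast
    then have "((\<lambda>z. ((1 + z) / 2) ^ m) has_derivative (\<lambda>h. c * h)) (at (F x))"
      by (simp add: has_field_derivative_def)
    moreover have "(F has_derivative F) (at x)"
      by (intro bounded_linear_imp_has_derivative clinear_functional_bounded_linear F)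
    ultimately have "((\<lambda>y. ((1 + F y) / 2) ^ m) has_derivative (\<lambda>v. c * F v)) (at x)"
      using has_derivative_compose by blast
    \<comment> \<open>\<open>to_unit_ball\<close> is controlled only on the unit ball, so the
      derivative is transferred on the open ball.\<close>
    then have "(ball_fun (peak_fun F m) has_derivative (\<lambda>v. c * F v)) (at x)"
      by (rule has_derivative_transform_within_open[of _ _ _ _ "ball 0 1"])
        (use x in \<open>auto simp: apply_peak_fun[OF F] of_unit_ball_to_unit_ball\<close>)
    moreover have "F (a *\<^sub>C v) = a * F v" for a v
      using F(1) by (simp add: clinear_functional_def)
    ultimately show "\<exists>D. (ball_fun (peak_fun F m) has_derivative D) (at x) \<and> (\<forall>c v. D (c *\<^sub>C v) = c * D v)"
      by (intro exI[of _ "\<lambda>v. c * F v"]) simp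
  qed
  then show ?thesis
    by (simp add: A_u_def apply_peak_fun[OF F] uniformly_continuous_peak_fun[OF F])
qed

text \<open>Since \<open>F x = 1\<close>, the number \<open>1 + F y = F (y + x)\<close> has modulus
  at most \<open>norm (y + x)\<close>. Points far from \<open>x\<close> with
  \<open>cmod ((1 + F y) / 2)\<close> tending to 1 would thus have \<open>norm (y + x)\<close>
  tending to 2, and local uniform convexity would force them to converge to
  \<open>x\<close>.\<close>

lemma luc_functional_peaks:
  fixes x :: "'a::complex_normed_vector"
  assumes luc: "locally_uniformly_convex TYPE('a)" and x: "norm x = 1"
    and F: "clinear_functional F" "\<And>y. cmod (F y) \<le> norm y" "F x = 1" and r: "r > 0"
  obtains q where "0 < q" "q < 1"
    "\<And>y. norm y \<le> 1 \<Longrightarrow> r \<le> dist y x \<Longrightarrow> cmod ((1 + F y) / 2) \<le> q"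
proof -
  \<comment> \<open>Using \<open>Suc (Suc n)\<close> keeps the bound strictly between 0 and 1 for
    every \<open>n\<close>, including 0.\<close>
  have "\<exists>n. \<forall>y. norm y \<le> 1 \<longrightarrow> r \<le> dist y x \<longrightarrow> cmod ((1 + F y) / 2) \<le> 1 - inverse (real (Suc (Suc n)))"
  proof (rule ccontr)
    assume "\<not> ?thesis"
    then have "\<forall>n. \<exists>y. norm y \<le> 1 \<and> r \<le> dist y x \<and> 1 - inverse (real (Suc (Suc n))) < cmod ((1 + F y) / 2)"
      by (simp only: not_ex not_all not_imp not_le simp_thms)
    then obtain y where y: "\<And>n. norm (y n) \<le> 1" "\<And>n. r \<le> dist (y n) x"
      "\<And>n. 1 - inverse (real (Suc (Suc n))) < cmod ((1 + F (y n)) / 2)"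
      by metis
    have lower: "2 - 2 * inverse (real (Suc (Suc n))) \<le> norm (y n + x)" for n
    proof -
      have "F (y n + x) = 1 + F (y n)"
        using F(1,3) by (simp add: clinear_functional_def)
      then have "cmod (1 + F (y n)) \<le> norm (y n + x)"
        using F(2)[of "y n + x"] by simp
      moreover have "cmod ((1 + F (y n)) / 2) = cmod (1 + F (y n)) / 2"
        by (simp add: norm_divide)
      ultimately show ?thesis
        using y(3)[of n] by linarith
    qed
    have upper: "norm (y n + x) \<le> 2" for n
      using norm_triangle_ineq[of "y n" x] y(1)[of n] x by linarith
    have "(\<lambda>n. 2 - 2 * inverse (real (Suc (Suc n)))) \<longlonglongrightarrow> 2 - 2 * 0"
      by (intro tendsto_intros LIMSEQ_Suc[OF LIMSEQ_inverse_real_of_nat])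
    then have "(\<lambda>n. 2 - 2 * inverse (real (Suc (Suc n)))) \<longlonglongrightarrow> 2"
      by simp
    then have "(\<lambda>n. norm (y n + x)) \<longlonglongrightarrow> 2"
      by (rule tendsto_sandwich[rotated 2])
        (rule tendsto_const, (intro always_eventually allI lower upper)+)
    then have "y \<longlonglongrightarrow> x"
      using luc x y(1) unfolding locally_uniformly_convex_def by simp
    then have "\<forall>\<^sub>F n in sequentially. dist (y n) x < r"
      using r by (rule tendstoD)
    then obtain n where "dist (y n) x < r"
      by (auto simp: eventually_sequentially)
    with y(2)[of n] show False by simp
  qed
  then obtain n where n: "\<And>y. norm y \<le> 1 \<Longrightarrow> r \<le> dist y x \<Longrightarrow>
      cmod ((1 + F y) / 2) \<le> 1 - inverse (real (Suc (Suc n)))"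
    by blast
  show thesis
    by (rule that[OF _ _ n]) (auto simp: field_simps)
qed

text \<open>Raising to a power keeps the value 1 at \<open>x\<close> and pushes the bound
  \<open>q < 1\<close> off the ball below 1/2.\<close>

lemma luc_peaks_near:
  fixes x :: "'a::complex_normed_vector"
  assumes luc: "locally_uniformly_convex TYPE('a)" and x: "norm x = 1" and r: "r > 0"
  obtains h where "h \<in> A_u" "peaks_near h (to_unit_ball x) r"
proof -
  obtain F where F: "clinear_functional F" "\<And>y. cmod (F y) \<le> norm y" and "F x = norm x"
    using ex_complex_norming_functional[of x] by blast
  then have Fx: "F x = 1"
    using x by simp
  obtain q where q: "0 < q" "q < 1"
    "\<And>y. norm y \<le> 1 \<Longrightarrow> r \<le> dist y x \<Longrightarrow> cmod ((1 + F y) / 2) \<le> q"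
    using luc_functional_peaks[OF luc x F Fx r] by blast
  obtain m where m: "q ^ m < 1 / 2"
    using real_arch_pow_inv[of "1 / 2" q] q by auto
  have "peaks_near (peak_fun F m) (to_unit_ball x) r"
    unfolding peaks_near_def
  proof (intro conjI allI impI)
    show "norm (peak_fun F m) \<le> 1"
      by (rule norm_peak_fun_le[OF F])
    show "ball_fun (peak_fun F m) x = 1"
      using x Fx by (simp add: apply_peak_fun[OF F] of_unit_ball_to_unit_ball)
    fix s assume "r \<le> dist s (to_unit_ball x)"
    then have "cmod ((1 + F (of_unit_ball s)) / 2) \<le> q"
      using x by (intro q(3)) (auto simp: norm_of_unit_ball dist_unit_ball_def of_unit_ball_to_unit_ball)
    then have "cmod (apply_bcontfun (peak_fun F m) s) \<le> q ^ m"
      unfolding apply_peak_fun[OF F] norm_power by (rule power_mono) simp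
    with m show "cmod (apply_bcontfun (peak_fun F m) s) \<le> 1 / 2"
      by simp
  qed
  then show thesis
    using peak_fun_in_A_u[OF F] that by blast
qed

text \<open>The zero space has no unit vectors, so the functionals above do not cover it.\<close>

lemma trivial_peaks_near:
  fixes s :: "'a::complex_normed_vector unit_ball"
  assumes trivial: "\<And>x::'a. x = 0" and r: "r > 0"
  obtains h where "h \<in> A_u" "peaks_near h s r"
proof -
  have F: "clinear_functional (\<lambda>_::'a. 0)" "cmod 0 \<le> norm y" for y :: 'a
    by (simp_all add: clinear_functional_def)
  have "dist t s < r" for t
    using r trivial[of "of_unit_ball t"] trivial[of "of_unit_ball s"] by (simp add: dist_unit_ball_def)
  \<comment> \<open>Exponent 0 gives the constant 1. Every point is within \<open>r\<close> of
    \<open>s\<close>, so the condition away from \<open>s\<close> is vacuous.\<close>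
  then have "peaks_near (peak_fun (\<lambda>_. 0) 0) s r"
    using norm_peak_fun_le[OF F, of 0] by (simp add: peaks_near_def apply_peak_fun[OF F] not_le)
  then show thesis
    using peak_fun_in_A_u[OF F] that by blast
qed

text \<open>The peaks already lie in the smaller space \<open>A_u\<close>, and the maximum modulus
  argument works in the larger space \<open>A_b\<close>, so both cases are treated at once.\<close>

lemma has_norming_peaks_between:
  fixes A :: "('a::complex_normed_vector unit_ball \<Rightarrow>\<^sub>C complex) set"
  assumes luc: "locally_uniformly_convex TYPE('a)" and A: "A_u \<subseteq> A" "A \<subseteq> A_b"
  shows "has_norming_peaks A"
  unfolding has_norming_peaks_def
proof (intro ballI allI impI)
  fix f :: "'a unit_ball \<Rightarrow>\<^sub>C complex" and c r :: real
  assume f: "f \<in> A" "c < norm f" "0 < r"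
  show "\<exists>s. c < cmod (apply_bcontfun f s) \<and> (\<exists>h\<in>A. peaks_near h s r)"
  proof (cases "\<exists>x::'a. x \<noteq> 0")
    case True
    then obtain x where "norm x = 1" "c < cmod (ball_fun f x)"
      using A_b_norm_gt_on_sphere[of f c] f A by blast
    moreover obtain h where "h \<in> A_u" "peaks_near h (to_unit_ball x) r"
      using luc_peaks_near[OF luc \<open>norm x = 1\<close> f(3)] .
    ultimately show ?thesis
      using A by blast
  next
    case False
    obtain s where "c < cmod (apply_bcontfun f s)"
      using f(2) by (rule bcontfun_cmod_gt)
    moreover obtain h where "h \<in> A_u" "peaks_near h s r"
      using trivial_peaks_near[OF _ f(3), of s] False by blast
    ultimately show ?thesis
      using A by blast
  qed
qed

theorem corollary3p1:
  fixes A :: "('x::complex_banach unit_ball \<Rightarrow>\<^sub>C complex) set"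
  assumes "locally_uniformly_convex TYPE('x)"
    and "A = A_b \<or> A = A_u"
  shows "dense_gdelta_in (top_of_set A) (strong_peak_functions A) \<and>
    (\<exists>D. D \<subseteq> smooth_points A \<and> dense_gdelta_in (top_of_set (A \<inter> sphere 0 1)) D)"
proof -
  have A: "csubspace A" "closed A"
    using assms(2) csubspace_A_b csubspace_A_u closed_A_b closed_A_u by auto
  have "A_u \<subseteq> A" "A \<subseteq> A_b"
    using assms(2) by (auto simp: A_u_def)
  then have "has_norming_peaks A"
    by (rule has_norming_peaks_between[OF assms(1)])
  then have "dense_gdelta_in (top_of_set A) (strong_peak_functions A)"
    by (rule strong_peak_functions_dense_gdelta[OF A(1) _ A(2)])
  \<comment> \<open>The witness \<open>D\<close> is the set of strong peak functions of norm
    1.\<close>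
  then show ?thesis
    using dense_gdelta_strong_peak_sphere[OF A(1)] strong_peak_functions_sphere_smooth[OF A(1)]
    by blast
qed

end
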